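(* Let $F(x)=\sum_{i=1}^n\phi_i(a_i^\top x)$ on $\mathbb{R}^d$, where each $\phi_i:\mathbb{R}\to\mathbb{R}$ is convex and $L$-smooth and $F$ is $\mu$-strongly convex, and let $\lambda>0$. Given a dual $(\sigma,\lambda)$-oracle $\mathcal{D}$ with running time $\mathcal{T}_{\mathcal{D}}$, where $$\sigma\ge 80\,n^2\kappa_\lambda^2\max\{\kappa,\kappa_\lambda\}\lceil\lambda/\mu\rceil,$$ the algorithm Dual APPA minimizes $F$ to within accuracy $\epsilon$ in time $\tilde O\big(\mathcal{T}_{\mathcal{D}}\lceil\lambda/\mu\rceil\log(\epsilon_0/\epsilon)\big)$, where $\epsilon_0=F(x^{(0)})-\min F$ is the initial error. (If the oracle is randomized, the expected error of the output is at most $\epsilon$.)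
   Context: $R=\max_i\|a_i\|_2$, $A\in\mathbb{R}^{n\times d}$ is the matrix with rows $a_i^\top$, $\kappa=\lceil LR^2/\mu\rceil$, $\kappa_\lambda=\lceil LR^2/\lambda\rceil$. $L$-smooth: $\phi(y)\le\phi(x)+\phi'(x)(y-x)+\frac L2(y-x)^2$ for all $x,y$. With $\phi_i^*$ the Fenchel conjugate of $\phi_i$, the dual objective with center $s\in\mathbb{R}^d$ is $g_{s,\lambda}(y)=\sum_{i=1}^n\phi_i^*(y_i)+\frac1{2\lambda}\|A^\top y\|_2^2-s^\top A^\top y$ for $y\in\mathbb{R}^n$, with $g_{s,\lambda}^{\mathrm{opt}}=\min_yg_{s,\lambda}(y)$. Dual-to-primal map: $\hat x_{s,\lambda}(y)=s-\frac1\lambda A^\top y$. Primal-to-dual map: $[\hat y(x)]_i=\phi_i'(a_i^\top x)$. A dual $(c,\lambda)$-oracle is an algorithm $\mathcal{D}$ that, given $s\in\mathbb{R}^d$ and $y\in\mathbb{R}^n$, outputs $\mathcal{D}(s,y)\in\mathbb{R}^n$ with $g_{s,\lambda}(\mathcal{D}(s,y))-g_{s,\lambda}^{\mathrm{opt}}\le\frac1c[g_{s,\lambda}(y)-g_{s,\lambda}^{\mathrm{opt}}]$ (in expectation if randomized), in time $\mathcal{T}_{\mathcal{D}}$. Dual APPA: input $x^{(0)}\in\mathbb{R}^d$, $\lambda>0$, a dual $(\sigma,\lambda)$-oracle $\mathcal{D}$; set $y^{(0)}=\hat y(x^{(0)})$; for $t=1,\dots,T$ set $y^{(t)}=\mathcal{D}(x^{(t-1)},y^{(t-1)})$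 and $x^{(t)}=\hat x_{x^{(t-1)},\lambda}(y^{(t)})$; output $x^{(T)}$. ($T$ is chosen suitably; the cost of the maps is absorbed in $\mathcal{T}_{\mathcal{D}}$.) $\tilde O(\cdot)$ hides factors polylogarithmic in $n,L,\mu,\lambda,R$; $\log(\epsilon_0/\epsilon)$ is read as $\max\{1,\log(\epsilon_0/\epsilon)\}$. *)

theory Defs
  imports "HOL-Probability.Probability"
begin

text \<open>
  The dimensions \<open>n\<close> and \<open>d\<close> are term-level numbers, because the constants hidden by the
  asymptotic notation must not depend on them. A vector of \<open>\<real>\<^sup>d\<close> is an extensional function on
  \<open>{..<d}\<close>, i.e. a point of the product Borel space \<open>borel_vec d\<close>; its Euclidean norm is
  \<^term>\<open>L2_set x {..<d}\<close>. The data of a problem are \<open>n\<close>, \<open>d\<close>, the matrix \<open>a\<close> (row \<open>i < n\<close>,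
  column \<open>j < d\<close>) and the losses \<open>\<phi> i\<close>, \<open>i < n\<close>.
\<close>

type_synonym rvec = "nat \<Rightarrow> real"

abbreviation borel_vec :: "nat \<Rightarrow> rvec measure" where
  "borel_vec d \<equiv> PiM {..<d} (\<lambda>_. borel)"

abbreviation carrier_vec :: "nat \<Rightarrow> rvec set" where
  "carrier_vec d \<equiv> PiE {..<d} (\<lambda>_. UNIV)"

definition dot :: "nat \<Rightarrow> rvec \<Rightarrow> rvec \<Rightarrow> real" where
  "dot d x y = (\<Sum>j<d. x j * y j)"

definition tmult :: "nat \<Rightarrow> nat \<Rightarrow> (nat \<Rightarrow> rvec) \<Rightarrow> rvec \<Rightarrow> rvec" where
  "tmult n d a y = (\<lambda>j\<in>{..<d}. \<Sum>i<n. a i j * y i)" \<comment> \<open>\<open>A\<^sup>T y\<close>\<close>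

definition max_row_norm :: "nat \<Rightarrow> nat \<Rightarrow> (nat \<Rightarrow> rvec) \<Rightarrow> real" where
  "max_row_norm n d a = Max ((\<lambda>i. L2_set (a i) {..<d}) ` {..<n})"

definition L_smooth :: "real \<Rightarrow> (real \<Rightarrow> real) \<Rightarrow> bool" where
  "L_smooth L f \<longleftrightarrow> (\<forall>x. f differentiable at x) \<and>
     (\<forall>x y. f y \<le> f x + deriv f x * (y - x) + L / 2 * (y - x)\<^sup>2)"

definition strongly_convex :: "nat \<Rightarrow> real \<Rightarrow> (rvec \<Rightarrow> real) \<Rightarrow> bool" where
  "strongly_convex d \<mu> f \<longleftrightarrow>
     (\<forall>x\<in>carrier_vec d. \<forall>y\<in>carrier_vec d. \<forall>t\<in>{0..1}.
        f (\<lambda>j\<in>{..<d}. (1 - t) * x j + t * y j)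
          \<le> (1 - t) * f x + t * f y - \<mu> / 2 * t * (1 - t) * (L2_set (\<lambda>j. x j - y j) {..<d})\<^sup>2)"

definition primal :: "nat \<Rightarrow> nat \<Rightarrow> (nat \<Rightarrow> rvec) \<Rightarrow> (nat \<Rightarrow> real \<Rightarrow> real) \<Rightarrow> rvec \<Rightarrow> real" where
  "primal n d a \<phi> x = (\<Sum>i<n. \<phi> i (dot d (a i) x))"

text \<open>
  \<open>min F\<close> and \<open>min g\<close> are rendered as infima; under the assumptions on the problem both are attained.
\<close>

definition primal_opt :: "nat \<Rightarrow> nat \<Rightarrow> (nat \<Rightarrow> rvec) \<Rightarrow> (nat \<Rightarrow> real \<Rightarrow> real) \<Rightarrow> real" where
  "primal_opt n d a \<phi> = (INF x\<in>carrier_vec d. primal n d a \<phi> x)"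

text \<open>The conjugate, and hence the dual objective, may take the value \<open>\<infinity>\<close> (but never \<open>-\<infinity>\<close>).\<close>

definition fenchel :: "(real \<Rightarrow> real) \<Rightarrow> real \<Rightarrow> ereal" where
  "fenchel f y = (SUP x. ereal (y * x - f x))"

definition dual ::
  "nat \<Rightarrow> nat \<Rightarrow> (nat \<Rightarrow> rvec) \<Rightarrow> (nat \<Rightarrow> real \<Rightarrow> real) \<Rightarrow> real \<Rightarrow> rvec \<Rightarrow> rvec \<Rightarrow> ereal" where
  "dual n d a \<phi> lam s y =
     (\<Sum>i<n. fenchel (\<phi> i) (y i)) +
     ereal (1 / (2 * lam) * (L2_set (tmult n d a y) {..<d})\<^sup>2 - dot d s (tmult n d a y))"

definition dual_opt ::
  "nat \<Rightarrow> nat \<Rightarrow> (nat \<Rightarrow> rvec) \<Rightarrow> (nat \<Rightarrow> real \<Rightarrow> real) \<Rightarrow> real \<Rightarrow> rvec \<Rightarrow> ereal" where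
  "dual_opt n d a \<phi> lam s = (INF y\<in>carrier_vec n. dual n d a \<phi> lam s y)"

definition dual_error ::
  "nat \<Rightarrow> nat \<Rightarrow> (nat \<Rightarrow> rvec) \<Rightarrow> (nat \<Rightarrow> real \<Rightarrow> real) \<Rightarrow> real \<Rightarrow> rvec \<Rightarrow> rvec \<Rightarrow> ereal" where
  "dual_error n d a \<phi> lam s y = dual n d a \<phi> lam s y - dual_opt n d a \<phi> lam s"

definition xhat :: "nat \<Rightarrow> nat \<Rightarrow> (nat \<Rightarrow> rvec) \<Rightarrow> real \<Rightarrow> rvec \<Rightarrow> rvec \<Rightarrow> rvec" where
  "xhat n d a lam s y = (\<lambda>j\<in>{..<d}. s j - 1 / lam * tmult n d a y j)"

definition yhat :: "nat \<Rightarrow> nat \<Rightarrow> (nat \<Rightarrow> rvec) \<Rightarrow> (nat \<Rightarrow> real \<Rightarrow> real) \<Rightarrow> rvec \<Rightarrow> rvec" where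
  "yhat n d a \<phi> x = (\<lambda>i\<in>{..<n}. deriv (\<phi> i) (dot d (a i) x))"

text \<open>
  An oracle call returns its output together with the number of elementary steps it took;
  \<open>TD\<close> bounds the latter. \<open>dual_oracle\<close> and \<open>dual_appa\<close> describe deterministic oracles.
  A randomized oracle is a Borel probability kernel; its step bound holds almost surely, and its
  error bound in expectation (a nonnegative integral, so that no integrability is presupposed).
\<close>

definition dual_oracle ::
  "nat \<Rightarrow> nat \<Rightarrow> (nat \<Rightarrow> rvec) \<Rightarrow> (nat \<Rightarrow> real \<Rightarrow> real) \<Rightarrow> real \<Rightarrow> real \<Rightarrow> real
    \<Rightarrow> (rvec \<Rightarrow> rvec \<Rightarrow> rvec \<times> nat) \<Rightarrow> bool" where
  "dual_oracle n d a \<phi> c lam TD D \<longleftrightarrow>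
     (\<forall>s\<in>carrier_vec d. \<forall>y\<in>carrier_vec n.
        fst (D s y) \<in> carrier_vec n \<and>
        real (snd (D s y)) \<le> TD \<and>
        dual_error n d a \<phi> lam s (fst (D s y)) \<le> ereal (1 / c) * dual_error n d a \<phi> lam s y)"

definition randomized_dual_oracle ::
  "nat \<Rightarrow> nat \<Rightarrow> (nat \<Rightarrow> rvec) \<Rightarrow> (nat \<Rightarrow> real \<Rightarrow> real) \<Rightarrow> real \<Rightarrow> real \<Rightarrow> real
    \<Rightarrow> (rvec \<Rightarrow> rvec \<Rightarrow> (rvec \<times> nat) measure) \<Rightarrow> bool" where
  "randomized_dual_oracle n d a \<phi> c lam TD K \<longleftrightarrow>
     (\<lambda>(s, y). K s y) \<in> borel_vec d \<Otimes>\<^sub>M borel_vec n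
                          \<rightarrow>\<^sub>M prob_algebra (borel_vec n \<Otimes>\<^sub>M count_space UNIV) \<and>
     (\<forall>s\<in>carrier_vec d. \<forall>y\<in>carrier_vec n.
        (AE r in K s y. real (snd r) \<le> TD) \<and>
        (\<integral>\<^sup>+ r. e2ennreal (dual_error n d a \<phi> lam s (fst r)) \<partial>K s y)
          \<le> e2ennreal (ereal (1 / c) * dual_error n d a \<phi> lam s y))"

text \<open>
  The state after \<open>t\<close> iterations: \<open>x\<^sup>(\<^sup>t\<^sup>)\<close>, \<open>y\<^sup>(\<^sup>t\<^sup>)\<close> and the number of steps used so far, where
  each evaluation of \<^const>\<open>xhat\<close> or \<^const>\<open>yhat\<close> is charged \<open>m\<close> steps.
\<close>

primrec dual_appa ::
  "nat \<Rightarrow> nat \<Rightarrow> (nat \<Rightarrow> rvec) \<Rightarrow> (nat \<Rightarrow> real \<Rightarrow> real) \<Rightarrow> real \<Rightarrow> nat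
    \<Rightarrow> (rvec \<Rightarrow> rvec \<Rightarrow> rvec \<times> nat) \<Rightarrow> rvec \<Rightarrow> nat \<Rightarrow> rvec \<times> rvec \<times> nat" where
  "dual_appa n d a \<phi> lam m D x0 0 = (x0, yhat n d a \<phi> x0, m)"
| "dual_appa n d a \<phi> lam m D x0 (Suc t) =
     (case dual_appa n d a \<phi> lam m D x0 t of (x, y, \<tau>) \<Rightarrow>
      case D x y of (y', c) \<Rightarrow> (xhat n d a lam x y', y', \<tau> + c + m))"

abbreviation appa_space :: "nat \<Rightarrow> nat \<Rightarrow> (rvec \<times> rvec \<times> nat) measure" where
  "appa_space n d \<equiv> borel_vec d \<Otimes>\<^sub>M borel_vec n \<Otimes>\<^sub>M count_space UNIV"

primrec randomized_dual_appa ::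
  "nat \<Rightarrow> nat \<Rightarrow> (nat \<Rightarrow> rvec) \<Rightarrow> (nat \<Rightarrow> real \<Rightarrow> real) \<Rightarrow> real \<Rightarrow> nat
    \<Rightarrow> (rvec \<Rightarrow> rvec \<Rightarrow> (rvec \<times> nat) measure) \<Rightarrow> rvec \<Rightarrow> nat \<Rightarrow> (rvec \<times> rvec \<times> nat) measure" where
  "randomized_dual_appa n d a \<phi> lam m K x0 0 =
     return (appa_space n d) (x0, yhat n d a \<phi> x0, m)"
| "randomized_dual_appa n d a \<phi> lam m K x0 (Suc t) =
     randomized_dual_appa n d a \<phi> lam m K x0 t \<bind> (\<lambda>(x, y, \<tau>).
     K x y \<bind> (\<lambda>(y', c). return (appa_space n d) (xhat n d a lam x y', y', \<tau> + c + m)))"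

text \<open>
  The factors hidden by the soft-O notation. Absolute values because the parameters may be smaller than 1,
  where e.g. \<open>\<bar>ln \<mu>\<bar> = ln (1 / \<mu>)\<close>.
\<close>

definition polylog :: "nat \<Rightarrow> nat \<Rightarrow> real \<Rightarrow> real \<Rightarrow> real \<Rightarrow> real \<Rightarrow> real" where
  "polylog k n L \<mu> lam R =
     (1 + \<bar>ln (real n)\<bar> + \<bar>ln L\<bar> + \<bar>ln \<mu>\<bar> + \<bar>ln lam\<bar> + \<bar>ln R\<bar>) ^ k"

end

theory Submission
  imports Defs
begin

text \<open>
  Write \<open>f\<^sub>s x = F x + \<lambda>/2 \<parallel>x - s\<parallel>\<^sup>2\<close>. Strong duality \<open>min g\<^sub>s = - min f\<^sub>s\<close> and the bound
  \<open>f\<^sub>s (x\<^sub>s y) - min f\<^sub>s \<le> 4 n \<kappa>\<^sub>\<lambda> (g\<^sub>s y - min g\<^sub>s)\<close>, with \<open>x\<^sub>s\<close> the dual-to-primal map, follow from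
  \<open>g\<^sub>s y + f\<^sub>s x \<ge> \<lambda>/2 \<parallel>x - x\<^sub>s y\<parallel>\<^sup>2\<close> and \<open>\<parallel>\<nabla>f\<^sub>s x\<parallel>\<^sup>2 \<le> 2 M (f\<^sub>s x - inf f\<^sub>s)\<close> by letting \<open>f\<^sub>s x\<close> tend to
  its infimum, so no minimizer is ever needed. An exact proximal step contracts \<open>F - min F\<close> by \<open>1 - \<rho>\<close>
  with \<open>\<rho> = \<mu> / (\<lambda> + \<mu>)\<close>, while moving the center to \<open>x\<^sub>s y\<close> raises the dual error to at most
  \<open>9 n \<kappa>\<^sub>\<lambda> (g\<^sub>s y - min g\<^sub>s) + (F s - min F)\<close>. Hence, for the given accuracy of the oracle, the potential
  \<open>(F x - min F) + \<rho>/2 (g\<^sub>x y - min g\<^sub>x)\<close> contracts by \<open>1 - \<rho>/2 \<le> 1 - 1/(4 \<lceil>\<lambda>/\<mu>\<rceil>)\<close> in every iteration,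
  in expectation if the oracle is randomized.
\<close>

section \<open>Elementary facts on norms, tangents, extended reals and conjugates\<close>

lemma power2_L2_set: "(L2_set x A)\<^sup>2 = (\<Sum>j\<in>A. (x j)\<^sup>2)"
  by (simp add: L2_set_def sum_nonneg)

lemma convex_on_ge_tangent:
  fixes f :: "real \<Rightarrow> real"
  assumes "convex_on UNIV f" "f differentiable at x"
  shows "f y \<ge> f x + deriv f x * (y - x)"
proof -
  have "(f has_real_derivative deriv f x) (at x within UNIV)"
    using assms(2) by (simp add: DERIV_deriv_iff_real_differentiable)
  from convex_on_imp_above_tangent[OF assms(1) _ _ _ this, of y] show ?thesis
    by (simp add: connected_UNIV)
qed

lemma e2ennreal_ereal_mult:
  assumes "0 < c" "0 \<le> x"
  shows "e2ennreal (ereal c * x) = ennreal c * e2ennreal x"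
  using assms by (cases x) (auto simp: ennreal_mult ennreal_mult_top)

lemma fenchel_ge: "ereal (y * u - f u) \<le> fenchel f y"
  unfolding fenchel_def by (rule SUP_upper) auto

text \<open>The supremum ranges over uncountably many \<open>u\<close>, but each term is continuous
  in \<open>y\<close>. Strict superlevel sets are therefore unions of open sets, so the conjugate is
  lower semicontinuous.\<close>

lemma borel_measurable_fenchel [measurable]: "fenchel f \<in> borel_measurable borel"
proof (rule borel_measurableI_greater)
  fix c
  have "{y. c < fenchel f y} = (\<Union>u. {y. c < ereal (y * u - f u)})"
    by (auto simp: fenchel_def less_SUP_iff)
  moreover have "open {y. c < ereal (y * u - f u)}" for u
    by (intro open_Collect_less continuous_intros continuous_on_ereal)
  ultimately show "{y \<in> space borel. c < fenchel f y} \<in> sets borel"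
    by (simp add: borel_open open_UN)
qed

lemma xhat_in_carrier [simp]: "xhat n d a lam s y \<in> carrier_vec d"
  by (simp add: xhat_def)

lemma yhat_in_carrier [simp]: "yhat n d a \<phi> x \<in> carrier_vec n"
  by (simp add: yhat_def)

section \<open>The primal problem and its proximal regularization\<close>

locale erm =
  fixes n d :: nat and a :: "nat \<Rightarrow> rvec" and \<phi> :: "nat \<Rightarrow> real \<Rightarrow> real" and L \<mu> lam :: real
  assumes n_pos: "0 < n" and d_pos: "0 < d" and mu_pos: "0 < \<mu>" and lam_pos: "0 < lam"
    and convex: "\<And>i. i < n \<Longrightarrow> convex_on UNIV (\<phi> i)"
    and smooth: "\<And>i. i < n \<Longrightarrow> L_smooth L (\<phi> i)"
    and strong: "strongly_convex d \<mu> (primal n d a \<phi>)"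
begin

abbreviation F :: "rvec \<Rightarrow> real" where "F \<equiv> primal n d a \<phi>"
abbreviation Fmin :: real where "Fmin \<equiv> primal_opt n d a \<phi>"
abbreviation R :: real where "R \<equiv> max_row_norm n d a"
abbreviation grad :: "rvec \<Rightarrow> rvec" where "grad x \<equiv> tmult n d a (yhat n d a \<phi> x)"
abbreviation subopt :: "rvec \<Rightarrow> real" where "subopt x \<equiv> F x - Fmin"

lemma differentiable_loss: "i < n \<Longrightarrow> \<phi> i differentiable at u"
  using smooth by (auto simp: L_smooth_def)

lemma loss_ge: "i < n \<Longrightarrow> \<phi> i v \<ge> \<phi> i u + deriv (\<phi> i) u * (v - u)"
  using convex_on_ge_tangent[OF convex differentiable_loss] by blast

lemma loss_le: "i < n \<Longrightarrow> \<phi> i v \<le> \<phi> i u + deriv (\<phi> i) u * (v - u) + L / 2 * (v - u)\<^sup>2"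
  using smooth by (auto simp: L_smooth_def)

text \<open>The tangent at 0 bounds the loss at 1 from below, the smoothness parabola bounds it from
  above, and the two bounds differ by \<open>L / 2\<close>. A loss is available because
  \<open>n\<close> is positive.\<close>

lemma L_nonneg: "0 \<le> L"
  using loss_ge[OF n_pos, of 0 1] loss_le[OF n_pos, of 1 0] by simp

lemma R_nonneg: "0 \<le> R"
proof -
  have "L2_set (a 0) {..<d} \<le> R"
    unfolding max_row_norm_def using n_pos by (intro Max_ge) auto
  thus ?thesis using L2_set_nonneg order_trans by blast
qed

lemma row_le: "i < n \<Longrightarrow> (\<Sum>j<d. (a i j)\<^sup>2) \<le> R\<^sup>2"
proof -
  assume "i < n"
  hence "L2_set (a i) {..<d} \<le> R"
    unfolding max_row_norm_def by (intro Max_ge) auto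
  hence "(L2_set (a i) {..<d})\<^sup>2 \<le> R\<^sup>2"
    by (intro power_mono) auto
  thus ?thesis by (simp add: power2_L2_set)
qed

lemma dot_diff: "dot d (a i) z - dot d (a i) x = (\<Sum>j<d. a i j * (z j - x j))"
  by (simp add: dot_def sum_subtractf right_diff_distrib)

lemma dot_diff_sq: 
  assumes "i < n"
  shows "(dot d (a i) z - dot d (a i) x)\<^sup>2 \<le> R\<^sup>2 * (\<Sum>j<d. (z j - x j)\<^sup>2)"
proof -
  have "(dot d (a i) z - dot d (a i) x)\<^sup>2 \<le> (\<Sum>j<d. (a i j)\<^sup>2) * (\<Sum>j<d. (z j - x j)\<^sup>2)"
    unfolding dot_diff by (rule Cauchy_Schwarz_ineq_sum)
  also have "\<dots> \<le> R\<^sup>2 * (\<Sum>j<d. (z j - x j)\<^sup>2)"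
    by (intro mult_right_mono row_le assms sum_nonneg) auto
  finally show ?thesis .
qed

text \<open>Adjointness of the data matrix and its transpose.\<close>

lemma sum_dot_eq_tmult: "(\<Sum>i<n. y i * (\<Sum>j<d. a i j * v j)) = (\<Sum>j<d. tmult n d a y j * v j)"
proof -
  have "(\<Sum>i<n. y i * (\<Sum>j<d. a i j * v j)) = (\<Sum>i<n. \<Sum>j<d. a i j * y i * v j)"
    by (simp add: sum_distrib_left mult_ac)
  also have "\<dots> = (\<Sum>j<d. \<Sum>i<n. a i j * y i * v j)"
    by (rule sum.swap)
  also have "\<dots> = (\<Sum>j<d. tmult n d a y j * v j)"
    by (intro sum.cong) (auto simp: tmult_def sum_distrib_right)
  finally show ?thesis .
qed

text \<open>The chain rule for \<open>F\<close>: it justifies the name \<open>grad\<close> for the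
  transpose applied to \<open>yhat\<close>.\<close>

lemma sum_deriv_eq_grad:
  "(\<Sum>i<n. deriv (\<phi> i) (dot d (a i) x) * (dot d (a i) z - dot d (a i) x))
     = (\<Sum>j<d. grad x j * (z j - x j))"
proof -
  have "(\<Sum>i<n. deriv (\<phi> i) (dot d (a i) x) * (dot d (a i) z - dot d (a i) x))
     = (\<Sum>i<n. yhat n d a \<phi> x i * (\<Sum>j<d. a i j * (z j - x j)))"
    by (simp add: yhat_def dot_diff)
  thus ?thesis by (simp add: sum_dot_eq_tmult)
qed

lemma primal_ge: "F z \<ge> F x + (\<Sum>j<d. grad x j * (z j - x j))"
proof -
  have "F x + (\<Sum>j<d. grad x j * (z j - x j)) = (\<Sum>i<n. \<phi> i (dot d (a i) x) +
     deriv (\<phi> i) (dot d (a i) x) * (dot d (a i) z - dot d (a i) x))"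
    by (simp add: primal_def sum.distrib flip: sum_deriv_eq_grad)
  also have "\<dots> \<le> F z"
    unfolding primal_def by (intro sum_mono loss_ge) auto
  finally show ?thesis .
qed

text \<open>Each of the \<open>n\<close> losses contributes curvature at most \<open>L\<close> times
  the squared norm of its row, so \<open>n * L * R^2\<close> is a smoothness constant of
  \<open>F\<close>.\<close>

lemma primal_le:
  "F z \<le> F x + (\<Sum>j<d. grad x j * (z j - x j)) + real n * L * R\<^sup>2 / 2 * (\<Sum>j<d. (z j - x j)\<^sup>2)"
proof -
  have "F z \<le> (\<Sum>i<n. (\<phi> i (dot d (a i) x) +
     deriv (\<phi> i) (dot d (a i) x) * (dot d (a i) z - dot d (a i) x))
     + L / 2 * (R\<^sup>2 * (\<Sum>j<d. (z j - x j)\<^sup>2)))"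
    unfolding primal_def
  proof (intro sum_mono)
    fix i assume i: "i \<in> {..<n}"
    have "L / 2 * (dot d (a i) z - dot d (a i) x)\<^sup>2 \<le> L / 2 * (R\<^sup>2 * (\<Sum>j<d. (z j - x j)\<^sup>2))"
      using i L_nonneg by (intro mult_left_mono dot_diff_sq) auto
    thus "\<phi> i (dot d (a i) z) \<le> \<phi> i (dot d (a i) x) +
      deriv (\<phi> i) (dot d (a i) x) * (dot d (a i) z - dot d (a i) x)
      + L / 2 * (R\<^sup>2 * (\<Sum>j<d. (z j - x j)\<^sup>2))"
      using loss_le[of i "dot d (a i) z" "dot d (a i) x"] i by simp
  qed
  also have "\<dots> = F x + (\<Sum>j<d. grad x j * (z j - x j)) + real n * L * R\<^sup>2 / 2 * (\<Sum>j<d. (z j - x j)\<^sup>2)"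
    unfolding sum.distrib by (simp add: primal_def flip: sum_deriv_eq_grad)
  finally show ?thesis .
qed

text \<open>Comparing the strong convexity inequality at the midpoint with the tangent plane gives
  quadratic growth without passing to a limit, at the price of half the modulus.\<close>

lemma primal_growth:
  assumes x: "x \<in> carrier_vec d" and z: "z \<in> carrier_vec d"
  shows "F z \<ge> F x + (\<Sum>j<d. grad x j * (z j - x j)) + \<mu> / 4 * (\<Sum>j<d. (z j - x j)\<^sup>2)"
proof -
  let ?w = "\<lambda>j\<in>{..<d}. (1 - 1/2) * x j + 1/2 * z j"
  have 1: "F ?w \<le> (1 - 1/2) * F x + 1/2 * F z - \<mu> / 2 * (1/2) * (1 - 1/2) * (\<Sum>j<d. (x j - z j)\<^sup>2)"
    using strong[unfolded strongly_convex_def power2_L2_set, THEN bspec, OF x, THEN bspec, OF z,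
        THEN bspec, of "1/2"] by simp
  have "(\<Sum>j<d. grad x j * (?w j - x j)) = (\<Sum>j<d. 1/2 * (grad x j * (z j - x j)))"
    by (intro sum.cong) (auto simp: field_simps)
  hence "(\<Sum>j<d. grad x j * (?w j - x j)) = 1/2 * (\<Sum>j<d. grad x j * (z j - x j))"
    by (simp only: sum_distrib_left)
  moreover have "(\<Sum>j<d. (x j - z j)\<^sup>2) = (\<Sum>j<d. (z j - x j)\<^sup>2)"
    by (simp add: power2_commute)
  ultimately show ?thesis using 1 primal_ge[of x ?w] by simp
qed

text \<open>Quadratic growth cannot exceed the smoothness bound between two distinct points, and the
  zero and all-ones vectors are distinct because \<open>d\<close> is positive. This gives
  \<open>L\<close> and \<open>R\<close> real logarithms and makes \<kappa>lam at least 1.\<close>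

lemma condition_pos: "0 < L * R\<^sup>2"
proof (rule ccontr)
  assume "\<not> 0 < L * R\<^sup>2"
  hence le: "L * R\<^sup>2 \<le> 0" by simp
  define x :: rvec where "x = (\<lambda>j\<in>{..<d}. 0)"
  define z :: rvec where "z = (\<lambda>j\<in>{..<d}. 1)"
  have c: "x \<in> carrier_vec d" "z \<in> carrier_vec d" by (auto simp: x_def z_def)
  have eq: "(\<Sum>j<d. (z j - x j)\<^sup>2) = real d" by (simp add: x_def z_def)
  have "\<mu> / 4 * real d \<le> real n * L * R\<^sup>2 / 2 * real d"
    using primal_growth[OF c] primal_le[of z x] unfolding eq by linarith
  also have "\<dots> = real n / 2 * real d * (L * R\<^sup>2)" by simp
  also have "\<dots> \<le> 0" by (rule mult_nonneg_nonpos[OF _ le]) simp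
  finally have "\<mu> / 4 * real d \<le> 0" .
  moreover have "0 < \<mu> / 4 * real d" using mu_pos d_pos by simp
  ultimately show False by simp
qed

lemma L_pos: "0 < L" and R_pos: "0 < R"
  using condition_pos L_nonneg R_nonneg by (simp_all add: zero_less_mult_iff not_le order.order_iff_strict)

text \<open>The quadratic minorant at the origin is minimized coordinate by coordinate by completing
  the square; the minimum of \<open>b * u + \<mu> / 4 * u^2\<close> is \<open>- b^2 / \<mu>\<close>.
  Boundedness makes the real infimum \<open>Fmin\<close> meaningful.\<close>

lemma bdd_below_primal: "bdd_below (F ` carrier_vec d)"
proof (rule bdd_belowI2)
  define x :: rvec where "x = (\<lambda>j\<in>{..<d}. 0)"
  have x: "x \<in> carrier_vec d" by (simp add: x_def)
  fix z assume z: "z \<in> carrier_vec d"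
  have "(\<Sum>j<d. - (grad x j)\<^sup>2 / \<mu>) \<le> (\<Sum>j<d. grad x j * (z j - x j) + \<mu> / 4 * (z j - x j)\<^sup>2)"
  proof (intro sum_mono)
    fix j
    have "0 \<le> (grad x j / \<mu> + (z j - x j) / 2)\<^sup>2 * \<mu>" using mu_pos by simp
    also have "\<dots> = (grad x j)\<^sup>2 / \<mu> + grad x j * (z j - x j) + \<mu> / 4 * (z j - x j)\<^sup>2"
      using mu_pos by (simp add: power2_eq_square field_simps)
    finally show "- (grad x j)\<^sup>2 / \<mu> \<le> grad x j * (z j - x j) + \<mu> / 4 * (z j - x j)\<^sup>2" by simp
  qed
  thus "F x + (\<Sum>j<d. - (grad x j)\<^sup>2 / \<mu>) \<le> F z"
    using primal_growth[OF x z] by (simp add: sum.distrib sum_distrib_left)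
qed

lemma primal_opt_le: "x \<in> carrier_vec d \<Longrightarrow> Fmin \<le> F x"
  unfolding primal_opt_def by (intro cINF_lower bdd_below_primal)

lemma le_primal_optI: "(\<And>x. x \<in> carrier_vec d \<Longrightarrow> c \<le> F x) \<Longrightarrow> c \<le> Fmin"
  unfolding primal_opt_def by (intro cINF_greatest) (auto simp: PiE_eq_empty_iff)

section \<open>The proximal objective and its infimum\<close>

definition prox_obj :: "rvec \<Rightarrow> rvec \<Rightarrow> real" where
  "prox_obj s x = F x + lam / 2 * (\<Sum>j<d. (x j - s j)\<^sup>2)"

definition prox_opt :: "rvec \<Rightarrow> real" where
  "prox_opt s = (INF x\<in>carrier_vec d. prox_obj s x)"

definition prox_grad :: "rvec \<Rightarrow> rvec \<Rightarrow> rvec" where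
  "prox_grad s x j = grad x j + lam * (x j - s j)"

text \<open>A smoothness constant of \<open>prox_obj s\<close>: that of \<open>F\<close> plus
  \<open>lam\<close> from the quadratic term.\<close>

definition M :: real where "M = real n * L * R\<^sup>2 + lam"

lemma M_pos: "0 < M"
  using L_pos lam_pos by (simp add: M_def add_nonneg_pos)

lemma primal_le_prox_obj: "F x \<le> prox_obj s x"
  using lam_pos by (simp add: prox_obj_def sum_nonneg)

lemma prox_obj_self [simp]: "prox_obj s s = F s"
  by (simp add: prox_obj_def)

lemma prox_opt_le: "x \<in> carrier_vec d \<Longrightarrow> prox_opt s \<le> prox_obj s x"
  unfolding prox_opt_def
  by (intro cINF_lower bdd_belowI2[where m = Fmin] order_trans[OF primal_opt_le primal_le_prox_obj])

lemma le_prox_optI: "(\<And>x. x \<in> carrier_vec d \<Longrightarrow> c \<le> prox_obj s x) \<Longrightarrow> c \<le> prox_opt s"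
  unfolding prox_opt_def by (intro cINF_greatest) (auto simp: PiE_eq_empty_iff)

lemma primal_opt_le_prox_opt: "Fmin \<le> prox_opt s"
  by (intro le_prox_optI order_trans[OF primal_opt_le primal_le_prox_obj])

lemma prox_obj_le:
  "prox_obj s z \<le> prox_obj s x + (\<Sum>j<d. prox_grad s x j * (z j - x j)) + M / 2 * (\<Sum>j<d. (z j - x j)\<^sup>2)"
proof -
  have "lam / 2 * (z j - s j)\<^sup>2 = lam / 2 * (x j - s j)\<^sup>2 + lam * (x j - s j) * (z j - x j)
      + lam / 2 * (z j - x j)\<^sup>2" for j
    by (simp add: power2_eq_square field_simps)
  hence "lam / 2 * (\<Sum>j<d. (z j - s j)\<^sup>2) = lam / 2 * (\<Sum>j<d. (x j - s j)\<^sup>2)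
      + (\<Sum>j<d. lam * (x j - s j) * (z j - x j)) + lam / 2 * (\<Sum>j<d. (z j - x j)\<^sup>2)"
    by (simp only: sum_distrib_left sum.distrib)
  thus ?thesis using primal_le[of z x]
    by (simp add: prox_obj_def prox_grad_def M_def sum.distrib distrib_right add_divide_distrib)
qed

text \<open>A gradient step of length \<open>1 / M\<close> lowers the objective by at least the
  squared gradient norm over \<open>2 * M\<close>, yet cannot go below the infimum.\<close>

lemma prox_grad_sq_le:
  assumes "x \<in> carrier_vec d"
  shows "(\<Sum>j<d. (prox_grad s x j)\<^sup>2) \<le> 2 * M * (prox_obj s x - prox_opt s)"
proof -
  let ?G = "\<Sum>j<d. (prox_grad s x j)\<^sup>2"
  let ?z = "\<lambda>j\<in>{..<d}. x j - prox_grad s x j / M"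
  have "prox_opt s \<le> prox_obj s ?z" by (intro prox_opt_le) auto
  also have "\<dots> \<le> prox_obj s x + (\<Sum>j<d. prox_grad s x j * (?z j - x j)) + M / 2 * (\<Sum>j<d. (?z j - x j)\<^sup>2)"
    by (rule prox_obj_le)
  also have "(\<Sum>j<d. prox_grad s x j * (?z j - x j)) = - ?G / M"
    by (simp add: power2_eq_square sum_negf flip: sum_divide_distrib)
  also have "(\<Sum>j<d. (?z j - x j)\<^sup>2) = ?G / M\<^sup>2"
    by (simp add: power_divide sum_divide_distrib)
  also have "prox_obj s x + - ?G / M + M / 2 * (?G / M\<^sup>2) = prox_obj s x - ?G / (2 * M)"
    using M_pos by (simp add: power2_eq_square field_simps)
  finally have "?G / (2 * M) \<le> prox_obj s x - prox_opt s" by simp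
  thus ?thesis using M_pos by (simp add: field_simps)
qed

text \<open>Points on the segment from \<open>s\<close> to an arbitrary \<open>x\<close> serve as
  test points for \<open>prox_opt s\<close>; strong convexity pays for the proximal term.\<close>

lemma prox_opt_contracts:
  assumes s: "s \<in> carrier_vec d"
  shows "prox_opt s - Fmin \<le> (1 - \<mu> / (lam + \<mu>)) * subopt s"
proof -
  \<comment> \<open>This \<open>t\<close> solves \<open>\<mu> * (1 - t) = lam * t\<close>, so that
    the strong convexity gain cancels the proximal term exactly.\<close>
  define t where "t = \<mu> / (lam + \<mu>)"
  have t: "0 < t" "t < 1" "\<mu> * (1 - t) = lam * t"
    using mu_pos lam_pos by (auto simp: t_def field_simps)
  \<comment> \<open>Solved for \<open>F x\<close>, the bound has a left side free of
    \<open>x\<close>, so it passes to the infimum without a minimizer.\<close>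
  have "(prox_opt s - (1 - t) * F s) / t \<le> Fmin"
  proof (rule le_primal_optI)
    fix x assume x: "x \<in> carrier_vec d"
    let ?w = "\<lambda>j\<in>{..<d}. (1 - t) * s j + t * x j"
    let ?D = "\<Sum>j<d. (s j - x j)\<^sup>2"
    have 1: "F ?w \<le> (1 - t) * F s + t * F x - \<mu> / 2 * t * (1 - t) * ?D"
      using strong[unfolded strongly_convex_def power2_L2_set, THEN bspec, OF s, THEN bspec, OF x,
        THEN bspec, of t] t by simp
    have "(\<Sum>j<d. (?w j - s j)\<^sup>2) = (\<Sum>j<d. t\<^sup>2 * (s j - x j)\<^sup>2)"
      by (intro sum.cong) (auto simp: power2_eq_square algebra_simps)
    hence "(\<Sum>j<d. (?w j - s j)\<^sup>2) = t\<^sup>2 * ?D" by (simp add: sum_distrib_left)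
    moreover have "\<mu> / 2 * t * (1 - t) * ?D = lam / 2 * (t\<^sup>2 * ?D)"
    proof -
      have "\<mu> / 2 * t * (1 - t) * ?D = (\<mu> * (1 - t)) / 2 * t * ?D" by simp
      also have "\<dots> = lam / 2 * (t\<^sup>2 * ?D)" unfolding t(3) by (simp add: power2_eq_square)
      finally show ?thesis .
    qed
    ultimately have "prox_obj s ?w \<le> (1 - t) * F s + t * F x"
      using 1 by (simp only: prox_obj_def le_diff_eq)
    moreover have "prox_opt s \<le> prox_obj s ?w" by (intro prox_opt_le) auto
    ultimately have "prox_opt s - (1 - t) * F s \<le> F x * t" by (simp add: mult.commute)
    thus "(prox_opt s - (1 - t) * F s) / t \<le> F x" using t by (simp add: pos_divide_le_eq)
  qed
  hence "prox_opt s - (1 - t) * F s \<le> Fmin * t" using t by (simp add: pos_divide_le_eq)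
  thus ?thesis unfolding t_def[symmetric] by (simp add: algebra_simps)
qed


section \<open>Duality\<close>

abbreviation g :: "rvec \<Rightarrow> rvec \<Rightarrow> ereal" where "g \<equiv> dual n d a \<phi> lam"
abbreviation err :: "rvec \<Rightarrow> rvec \<Rightarrow> ereal" where "err \<equiv> dual_error n d a \<phi> lam"

text \<open>Equality in the Fenchel-Young inequality: the tangent at \<open>u\<close> lies below the
  loss, so the supremum is attained at \<open>u\<close>.\<close>

lemma fenchel_deriv: 
  assumes "i < n"
  shows "fenchel (\<phi> i) (deriv (\<phi> i) u) = ereal (deriv (\<phi> i) u * u - \<phi> i u)"
proof (rule antisym[OF _ fenchel_ge])
  show "fenchel (\<phi> i) (deriv (\<phi> i) u) \<le> ereal (deriv (\<phi> i) u * u - \<phi> i u)"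
    unfolding fenchel_def
    using loss_ge[OF assms, of u] by (intro SUP_least) (auto simp: algebra_simps)
qed

text \<open>Everything in the dual and proximal objectives apart from losses and conjugates forms
  one perfect square. Both weak duality and the exact dual value at \<open>yhat\<close> rest on
  this.\<close>

lemma completed_square:
  "dot d (tmult n d a y) x + (1 / (2 * lam) * (L2_set (tmult n d a y) {..<d})\<^sup>2 - dot d s (tmult n d a y))
     + lam / 2 * (\<Sum>j<d. (x j - s j)\<^sup>2)
   = (\<Sum>j<d. (tmult n d a y j + lam * (x j - s j))\<^sup>2) / (2 * lam)"
proof -
  let ?w = "tmult n d a y"
  have "(\<Sum>j<d. (?w j + lam * (x j - s j))\<^sup>2) / (2 * lam) =
    (\<Sum>j<d. ?w j * x j + (1 / (2 * lam) * (?w j)\<^sup>2 - s j * ?w j) + lam / 2 * (x j - s j)\<^sup>2)"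
    unfolding sum_divide_distrib using lam_pos
    by (intro sum.cong) (auto simp: power2_eq_square field_simps)
  thus ?thesis
    by (simp add: sum.distrib sum_subtractf dot_def power2_L2_set sum_distrib_left)
qed

lemma sum_mult_dot: "(\<Sum>i<n. y i * dot d (a i) x) = dot d (tmult n d a y) x"
  by (simp add: dot_def sum_dot_eq_tmult)

lemma xhat_diff_sq:
  "lam / 2 * (\<Sum>j<d. (x j - xhat n d a lam s y j)\<^sup>2)
    = (\<Sum>j<d. (tmult n d a y j + lam * (x j - s j))\<^sup>2) / (2 * lam)"
  unfolding sum_divide_distrib sum_distrib_left using lam_pos
  by (intro sum.cong) (auto simp: xhat_def power2_eq_square field_simps)

text \<open>Fenchel-Young for each loss at \<open>dot d (a i) x\<close>, then the completed square.
  Keeping the square, rather than discarding it, is what later controls the distance from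
  \<open>x\<close> to \<open>xhat\<close>.\<close>

lemma weak_duality:
  "ereal (lam / 2 * (\<Sum>j<d. (x j - xhat n d a lam s y j)\<^sup>2) - prox_obj s x) \<le> g s y"
proof -
  let ?q = "1 / (2 * lam) * (L2_set (tmult n d a y) {..<d})\<^sup>2 - dot d s (tmult n d a y)"
  have "ereal ((\<Sum>i<n. y i * dot d (a i) x - \<phi> i (dot d (a i) x)) + ?q) \<le> g s y"
    unfolding dual_def plus_ereal.simps(1)[symmetric] sum_ereal[symmetric]
    by (intro add_right_mono sum_mono fenchel_ge)
  moreover have "(\<Sum>i<n. y i * dot d (a i) x - \<phi> i (dot d (a i) x)) + ?q =
      lam / 2 * (\<Sum>j<d. (x j - xhat n d a lam s y j)\<^sup>2) - prox_obj s x"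
    unfolding sum_subtractf sum_mult_dot xhat_diff_sq
    using completed_square[of y x s] by (simp add: prox_obj_def primal_def)
  ultimately show ?thesis by simp
qed

text \<open>At \<open>yhat\<close> every Fenchel-Young inequality is tight, and the remaining square
  is the squared gradient of the proximal objective.\<close>

lemma dual_yhat:
  "g s (yhat n d a \<phi> x) = ereal ((\<Sum>j<d. (prox_grad s x j)\<^sup>2) / (2 * lam) - prox_obj s x)"
proof -
  let ?y = "yhat n d a \<phi> x"
  have "(\<Sum>i<n. fenchel (\<phi> i) (?y i)) = (\<Sum>i<n. ereal (?y i * dot d (a i) x - \<phi> i (dot d (a i) x)))"
    by (intro sum.cong) (auto simp: yhat_def fenchel_deriv)
  hence "(\<Sum>i<n. fenchel (\<phi> i) (?y i)) = ereal (dot d (tmult n d a ?y) x - F x)"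
    by (simp add: sum_subtractf sum_mult_dot primal_def)
  thus ?thesis using completed_square[of ?y x s]
    by (simp add: dual_def prox_obj_def prox_grad_def)
qed

lemma neg_prox_opt_le_dual: "ereal (- prox_opt s) \<le> g s y"
proof (cases "g s y")
  case (real v)
  have "- v \<le> prox_opt s"
  proof (rule le_prox_optI)
    fix x
    have "0 \<le> lam / 2 * (\<Sum>j<d. (x j - xhat n d a lam s y j)\<^sup>2)"
      using lam_pos by (intro mult_nonneg_nonneg sum_nonneg) auto
    thus "- v \<le> prox_obj s x" using weak_duality[of x s y] real by simp
  qed
  thus ?thesis using real by simp
\<comment> \<open>An infinite dual value is harmless, and minus infinity contradicts the finite
  lower bound of weak duality.\<close>
qed (use weak_duality[of s s y] in auto)

text \<open>Strong duality: a near-minimizer \<open>x\<close> of the proximal objective has a small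
  gradient, so by \<open>dual_yhat\<close> the dual value at \<open>yhat\<close> nearly reaches
  \<open>- prox_opt s\<close>.\<close>

lemma dual_opt_eq: "dual_opt n d a \<phi> lam s = ereal (- prox_opt s)"
proof (rule antisym)
  show "ereal (- prox_opt s) \<le> dual_opt n d a \<phi> lam s"
    unfolding dual_opt_def by (intro INF_greatest neg_prox_opt_le_dual)
next
  show "dual_opt n d a \<phi> lam s \<le> ereal (- prox_opt s)"
  proof (rule ereal_le_epsilon2)
    fix e :: real assume e: "0 < e"
    \<comment> \<open>The gradient bound multiplies the primal gap by \<open>M / lam\<close>, so a
      gap of \<open>e'\<close> yields \<open>e\<close>.\<close>
    define e' where "e' = e * lam / M"
    have e': "0 < e'" using e lam_pos M_pos by (simp add: e'_def)
    hence "\<not> prox_opt s + e' \<le> prox_opt s" by simp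
    then obtain x where x: "x \<in> carrier_vec d" "prox_obj s x < prox_opt s + e'"
      using le_prox_optI[of "prox_opt s + e'" s] by (meson not_le)
    have "dual_opt n d a \<phi> lam s \<le> g s (yhat n d a \<phi> x)"
      unfolding dual_opt_def by (intro INF_lower) simp
    also have "\<dots> \<le> ereal (- prox_opt s + e)"
    proof -
      have "(\<Sum>j<d. (prox_grad s x j)\<^sup>2) / (2 * lam) \<le> 2 * M * (prox_obj s x - prox_opt s) / (2 * lam)"
        using prox_grad_sq_le[OF x(1)] lam_pos by (intro divide_right_mono) auto
      also have "\<dots> = M / lam * (prox_obj s x - prox_opt s)" by simp
      also have "\<dots> \<le> M / lam * e'"
        using x M_pos lam_pos by (intro mult_left_mono) auto
      also have "\<dots> = e" using M_pos lam_pos by (simp add: e'_def)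
      finally show ?thesis using prox_opt_le[OF x(1), of s] by (simp add: dual_yhat)
    qed
    finally show "dual_opt n d a \<phi> lam s \<le> ereal (- prox_opt s) + ereal e" by simp
  qed
qed

lemma err_eq: "err s y = g s y + ereal (prox_opt s)"
  by (simp add: dual_error_def dual_opt_eq minus_ereal_def)

lemma err_nonneg: "0 \<le> err s y"
  unfolding dual_error_def dual_opt_eq
  by (rule ereal_diff_positive[OF neg_prox_opt_le_dual])

section \<open>Error bounds for the dual-to-primal map and the change of center\<close>

abbreviation \<kappa>lam :: real where "\<kappa>lam \<equiv> real_of_int \<lceil>L * R\<^sup>2 / lam\<rceil>"

lemma kappa_lam_ge: "1 \<le> \<kappa>lam" "L * R\<^sup>2 / lam \<le> \<kappa>lam"
proof -
  have "0 < L * R\<^sup>2 / lam" using condition_pos lam_pos by simp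
  hence "1 \<le> \<lceil>L * R\<^sup>2 / lam\<rceil>" by linarith
  thus "1 \<le> \<kappa>lam" by linarith
qed simp

lemma n_kappa_lam_ge: "1 \<le> real n * \<kappa>lam"
  using mult_mono[of 1 "real n" 1 \<kappa>lam] n_pos kappa_lam_ge by simp

lemma M_div_lam_le: "M / lam \<le> 2 * (real n * \<kappa>lam)"
proof -
  have "M / lam = real n * (L * R\<^sup>2 / lam) + 1"
    using lam_pos by (simp add: M_def field_simps)
  also have "\<dots> \<le> real n * \<kappa>lam + real n * \<kappa>lam"
    using n_kappa_lam_ge kappa_lam_ge by (intro add_mono mult_left_mono) auto
  finally show ?thesis by simp
qed

text \<open>Weak duality keeps \<open>xhat\<close> near any good \<open>x\<close>, and smoothness
  turns this distance into a bound on the objective; the reference point \<open>x\<close> is then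
  removed by an infimum.\<close>

lemma xhat_suboptimal:
  assumes err: "err s y = ereal e"
  shows "prox_obj s (xhat n d a lam s y) - prox_opt s \<le> 4 * (real n * \<kappa>lam) * e"
proof -
  let ?z = "xhat n d a lam s y"
  have z: "?z \<in> carrier_vec d" by simp
  obtain v where v: "g s y = ereal v" "e = v + prox_opt s"
    using err unfolding err_eq by (cases "g s y") auto
  have e0: "0 \<le> e" using err_nonneg[of s y] err by simp
  have key: "prox_obj s ?z - prox_opt s \<le> 2 * (prox_obj s x - prox_opt s) + 2 * M / lam * (v + prox_obj s x)"
    if x: "x \<in> carrier_vec d" for x
  proof -
    let ?D = "\<Sum>j<d. (?z j - x j)\<^sup>2"
    let ?G = "\<Sum>j<d. (prox_grad s x j)\<^sup>2"
    \<comment> \<open>Young's inequality with weight \<open>M\<close> splits the linear term into a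
      gradient part and a distance part.\<close>
    have "(\<Sum>j<d. prox_grad s x j * (?z j - x j))
        \<le> (\<Sum>j<d. (prox_grad s x j)\<^sup>2 / (2 * M) + M / 2 * (?z j - x j)\<^sup>2)"
    proof (intro sum_mono)
      fix j
      have "0 \<le> (prox_grad s x j - M * (?z j - x j))\<^sup>2 / (2 * M)" using M_pos by simp
      also have "\<dots> = (prox_grad s x j)\<^sup>2 / (2 * M) + M / 2 * (?z j - x j)\<^sup>2 - prox_grad s x j * (?z j - x j)"
        using M_pos by (simp add: power2_eq_square field_simps)
      finally show "prox_grad s x j * (?z j - x j) \<le> (prox_grad s x j)\<^sup>2 / (2 * M) + M / 2 * (?z j - x j)\<^sup>2"
        by simp
    qed
    also have "\<dots> = ?G / (2 * M) + M / 2 * ?D"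
      by (simp only: sum.distrib sum_distrib_left sum_divide_distrib)
    finally have 1: "prox_obj s ?z \<le> prox_obj s x + ?G / (2 * M) + M * ?D"
      using prox_obj_le[of s ?z x] by simp
    have "?G / (2 * M) \<le> prox_obj s x - prox_opt s"
      using prox_grad_sq_le[OF x, of s] M_pos by (simp add: field_simps)
    moreover have "M * ?D \<le> 2 * M / lam * (v + prox_obj s x)"
    proof -
      have "lam / 2 * ?D \<le> v + prox_obj s x"
        using weak_duality[of x s y] v by (simp add: power2_commute)
      hence "2 * M / lam * (lam / 2 * ?D) \<le> 2 * M / lam * (v + prox_obj s x)"
        using M_pos lam_pos by (intro mult_left_mono) auto
      thus ?thesis using lam_pos by simp
    qed
    ultimately have "prox_obj s x + ?G / (2 * M) + M * ?D
        \<le> prox_obj s x + (prox_obj s x - prox_opt s) + 2 * M / lam * (v + prox_obj s x)"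
      by (intro add_mono order_refl)
    from order_trans[OF 1 this] show ?thesis by simp
  qed
  \<comment> \<open>\<open>c\<close> is the total coefficient of \<open>prox_obj s x\<close> in
    \<open>key\<close>. Dividing by it allows the passage to the infimum over \<open>x\<close>,
    where the first term of \<open>key\<close> vanishes and the second becomes a multiple of
    \<open>e\<close>.\<close>
  define c where "c = 2 + 2 * M / lam"
  have c: "0 < c" using M_pos lam_pos by (simp add: c_def add_pos_pos)
  have "(prox_obj s ?z + prox_opt s - 2 * M / lam * v) / c \<le> prox_opt s"
  proof (rule le_prox_optI)
    fix x assume x: "x \<in> carrier_vec d"
    have "prox_obj s ?z + prox_opt s - 2 * M / lam * v \<le> prox_obj s x * c"
      using key[OF x] by (simp add: c_def algebra_simps add_divide_distrib)
    thus "(prox_obj s ?z + prox_opt s - 2 * M / lam * v) / c \<le> prox_obj s x"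
      using c by (simp add: pos_divide_le_eq)
  qed
  hence "prox_obj s ?z + prox_opt s - 2 * M / lam * v \<le> prox_opt s * c"
    using c by (simp add: pos_divide_le_eq)
  hence "prox_obj s ?z - prox_opt s \<le> 2 * (M / lam) * e"
    by (simp add: c_def v algebra_simps add_divide_distrib)
  also have "\<dots> \<le> 2 * (2 * (real n * \<kappa>lam)) * e"
    using M_div_lam_le e0 by (intro mult_right_mono) auto
  finally show ?thesis by simp
qed

text \<open>Only the linear term depends on the center, and by definition of \<open>xhat\<close> the
  transpose applied to \<open>y\<close> is \<open>- lam\<close> times the displacement of the
  center.\<close>

lemma dual_recenter:
  "g (xhat n d a lam s y) y = g s y + ereal (lam * (\<Sum>j<d. (xhat n d a lam s y j - s j)\<^sup>2))"
proof -
  have "dot d s (tmult n d a y) - dot d (xhat n d a lam s y) (tmult n d a y)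
      = lam * (\<Sum>j<d. (xhat n d a lam s y j - s j)\<^sup>2)"
    unfolding dot_def sum_subtractf[symmetric] sum_distrib_left using lam_pos
    by (intro sum.cong) (auto simp: xhat_def power2_eq_square field_simps)
  thus ?thesis unfolding dual_def add.assoc plus_ereal.simps(1)
    by (intro arg_cong2[of _ _ _ _ "(+)"]) auto
qed

lemma err_recenter:
  assumes s: "s \<in> carrier_vec d" and err: "err s y = ereal e"
  shows "err (xhat n d a lam s y) y \<le> ereal (9 * (real n * \<kappa>lam) * e + subopt s)"
proof -
  let ?z = "xhat n d a lam s y"
  have z: "?z \<in> carrier_vec d" by simp
  obtain v where v: "g s y = ereal v" "e = v + prox_opt s"
    using err unfolding err_eq by (cases "g s y") auto
  have e0: "0 \<le> e" using err_nonneg[of s y] err by simp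
  define D where "D = lam / 2 * (\<Sum>j<d. (?z j - s j)\<^sup>2)"
  have D: "prox_obj s ?z = F ?z + D" by (simp add: prox_obj_def D_def)
  have "err ?z y = ereal (v + 2 * D + prox_opt ?z)"
    by (simp add: err_eq dual_recenter v D_def)
  \<comment> \<open>\<open>xhat_suboptimal\<close> bounds \<open>D\<close> by
    \<open>4 * N * e + prox_opt s - F ?z\<close>. Doubling gives 8, and \<open>e\<close> itself, at
    most \<open>N * e\<close>, raises the constant to 9.\<close>
  moreover have "v + 2 * D + prox_opt ?z \<le> 9 * (real n * \<kappa>lam) * e + subopt s"
    using xhat_suboptimal[OF err] prox_opt_le[OF z, of ?z] prox_opt_le[OF s, of s] primal_opt_le[OF z]
      D v mult_right_mono[OF n_kappa_lam_ge e0] by simp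
  ultimately show ?thesis by simp
qed

lemma err_init:
  assumes x: "x \<in> carrier_vec d"
  shows "err x (yhat n d a \<phi> x) \<le> ereal (2 * (real n * \<kappa>lam) * subopt x)"
proof -
  have le: "prox_opt x \<le> F x" using prox_opt_le[OF x, of x] by simp
  have "(\<Sum>j<d. (prox_grad x x j)\<^sup>2) / (2 * lam) \<le> 2 * M * (F x - prox_opt x) / (2 * lam)"
    using prox_grad_sq_le[OF x, of x] lam_pos by (intro divide_right_mono) auto
  also have "\<dots> = M / lam * (F x - prox_opt x)" by simp
  also have "\<dots> \<le> 2 * (real n * \<kappa>lam) * subopt x"
    using M_div_lam_le le primal_opt_le_prox_opt[of x] n_kappa_lam_ge by (intro mult_mono) auto
  finally have "(\<Sum>j<d. (prox_grad x x j)\<^sup>2) / (2 * lam) \<le> 2 * (real n * \<kappa>lam) * subopt x" .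
  thus ?thesis using le by (simp add: err_eq dual_yhat)
qed


section \<open>Contraction of the potential\<close>

abbreviation q :: real where "q \<equiv> real_of_int \<lceil>lam / \<mu>\<rceil>"
abbreviation \<kappa> :: real where "\<kappa> \<equiv> real_of_int \<lceil>L * R\<^sup>2 / \<mu>\<rceil>"
abbreviation N :: real where "N \<equiv> real n * \<kappa>lam"

definition \<rho> :: real where "\<rho> = \<mu> / (lam + \<mu>)"

lemma q_ge_1: "1 \<le> q"
proof -
  have "0 < lam / \<mu>" using lam_pos mu_pos by simp
  hence "1 \<le> \<lceil>lam / \<mu>\<rceil>" by linarith
  thus ?thesis by linarith
qed

lemma rho_bounds: "0 < \<rho>" "\<rho> < 1" "1 / (2 * q) \<le> \<rho>"
proof -
  show "0 < \<rho>" "\<rho> < 1" using lam_pos mu_pos by (auto simp: \<rho>_def)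
  have "lam / \<mu> + 1 \<le> 2 * q" using q_ge_1 by linarith
  moreover have "\<rho> = 1 / (lam / \<mu> + 1)" using lam_pos mu_pos by (simp add: \<rho>_def field_simps)
  moreover have "0 < lam / \<mu> + 1" using lam_pos mu_pos by (simp add: add_pos_pos)
  ultimately show "1 / (2 * q) \<le> \<rho>" by (simp add: frac_le)
qed

text \<open>Values in \<open>ennreal\<close> allow an infinite dual error and nonnegative integrals.
  The weight \<rho>/2 spends half of the primal contraction on the term \<open>subopt\<close>
  created by recentering.\<close>

definition potential :: "rvec \<Rightarrow> rvec \<Rightarrow> ennreal" where
  "potential x y = ennreal (subopt x) + ennreal (\<rho> / 2) * e2ennreal (err x y)"

lemma subopt_le_potential: "ennreal (subopt x) \<le> potential x y"
  by (simp add: potential_def)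

text \<open>The bound is affine in the dual error after the oracle call, so it can be evaluated
  pointwise or integrated; deterministic and randomized oracles share it.\<close>

lemma potential_after_oracle:
  assumes x: "x \<in> carrier_vec d"
  shows "potential (xhat n d a lam x y) y \<le>
    ennreal ((1 - \<rho> / 2) * subopt x) + ennreal (4 * N + \<rho> / 2 * (9 * N)) * e2ennreal (err x y)"
proof (cases "err x y")
  case (real e)
  let ?z = "xhat n d a lam x y"
  have z: "?z \<in> carrier_vec d" by simp
  have e0: "0 \<le> e" using err_nonneg[of x y] real by simp
  have h0: "0 \<le> subopt x" "0 \<le> subopt ?z" using primal_opt_le x z by auto
  have N0: "0 \<le> N" using n_kappa_lam_ge by linarith
  have "subopt ?z \<le> (1 - \<rho>) * subopt x + 4 * N * e"
    using xhat_suboptimal[OF real] primal_le_prox_obj[of ?z x] prox_opt_contracts[OF x]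
    unfolding \<rho>_def by simp
  moreover have "e2ennreal (err ?z y) \<le> ennreal (9 * N * e + subopt x)"
    using e2ennreal_mono[OF err_recenter[OF x real]] by simp
  ultimately have "potential ?z y \<le> ennreal ((1 - \<rho>) * subopt x + 4 * N * e)
      + ennreal (\<rho> / 2) * ennreal (9 * N * e + subopt x)"
    unfolding potential_def by (intro add_mono mult_left_mono ennreal_leI) auto
  also have "\<dots> = ennreal ((1 - \<rho>) * subopt x + 4 * N * e + \<rho> / 2 * (9 * N * e + subopt x))"
    using rho_bounds h0 N0 e0 by (simp flip: ennreal_mult ennreal_plus)
  also have "\<dots> = ennreal ((1 - \<rho> / 2) * subopt x + (4 * N + \<rho> / 2 * (9 * N)) * e)"
    by (intro arg_cong[where f = ennreal]) (simp add: algebra_simps)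
  also have "\<dots> = ennreal ((1 - \<rho> / 2) * subopt x) + ennreal (4 * N + \<rho> / 2 * (9 * N)) * ennreal e"
    using rho_bounds h0 N0 e0 by (simp flip: ennreal_mult ennreal_plus)
  finally show ?thesis using real by simp
next
  case PInf
  \<comment> \<open>A positive coefficient makes the right-hand side infinite.\<close>
  have "0 < 4 * N + \<rho> / 2 * (9 * N)"
    using n_kappa_lam_ge rho_bounds by (intro add_pos_nonneg) auto
  thus ?thesis by (simp add: PInf ennreal_mult_top)
qed (use err_nonneg[of x y] in auto)

lemma accuracy_suffices:
  assumes \<sigma>: "80 * (real n)\<^sup>2 * \<kappa>lam\<^sup>2 * max \<kappa> \<kappa>lam * q \<le> \<sigma>"
  shows "0 < \<sigma>" and "(4 * N + \<rho> / 2 * (9 * N)) / \<sigma> \<le> (1 - \<rho> / 2) * (\<rho> / 2)"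
proof -
  have N: "1 \<le> N" by (rule n_kappa_lam_ge)
  have "N * 1 \<le> N * N" using N by (intro mult_left_mono) auto
  also have "N * N * 1 \<le> N * N * max \<kappa> \<kappa>lam"
    using N by (intro mult_left_mono max.coboundedI2 kappa_lam_ge) auto
  finally have "80 * N * q \<le> 80 * (N * N * max \<kappa> \<kappa>lam) * q"
    using q_ge_1 by (intro mult_right_mono) auto
  also have "\<dots> \<le> \<sigma>" using \<sigma> by (simp add: power2_eq_square mult_ac)
  finally have 1: "80 * N * q \<le> \<sigma>" .
  moreover have "0 < 80 * N * q" using N q_ge_1 by simp
  ultimately show pos: "0 < \<sigma>" by linarith
  have "N \<le> \<sigma> * (1 / (80 * q))" using 1 q_ge_1 by (simp add: field_simps)
  also have "1 / (80 * q) \<le> \<rho> / 40" using rho_bounds(3) by simp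
  hence "\<sigma> * (1 / (80 * q)) \<le> \<sigma> * (\<rho> / 40)" using pos by (intro mult_left_mono) auto
  finally have N_le: "N \<le> \<sigma> * (\<rho> / 40)" .
  \<comment> \<open>Since \<rho> is below 1, the coefficient is at most \<open>17 / 2\<close>.
    Together with \<open>N_le\<close> this leaves \<open>17 / 80\<close>, below
    \<open>1 / 4\<close>, while \<open>(1 - \<rho> / 2) / 2\<close> is at least
    \<open>1 / 4\<close>.\<close>
  have "4 * N + \<rho> / 2 * (9 * N) = (4 + 9 / 2 * \<rho>) * N" by (simp add: algebra_simps)
  also have "\<dots> \<le> (4 + 9 / 2) * (\<sigma> * (\<rho> / 40))"
    by (rule mult_mono[OF _ N_le]) (use rho_bounds N in linarith)+
  also have "\<dots> \<le> (\<sigma> * \<rho>) * (1 / 4)" using pos rho_bounds by simp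
  also have "\<dots> \<le> (\<sigma> * \<rho>) * ((1 - \<rho> / 2) / 2)"
    using pos rho_bounds by (intro mult_left_mono) auto
  finally show "(4 * N + \<rho> / 2 * (9 * N)) / \<sigma> \<le> (1 - \<rho> / 2) * (\<rho> / 2)"
    using pos by (simp add: field_simps)
qed

text \<open>\<open>I\<close> stands for the dual error after the oracle call, or for its
  expectation.\<close>

lemma potential_contracts:
  assumes x: "x \<in> carrier_vec d"
    and \<sigma>: "80 * (real n)\<^sup>2 * \<kappa>lam\<^sup>2 * max \<kappa> \<kappa>lam * q \<le> \<sigma>"
    and I: "I \<le> ennreal (1 / \<sigma>) * e2ennreal (err x y)"
  shows "ennreal ((1 - \<rho> / 2) * subopt x) + ennreal (4 * N + \<rho> / 2 * (9 * N)) * I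
    \<le> ennreal (1 - \<rho> / 2) * potential x y"
proof -
  note \<sigma>' = accuracy_suffices[OF \<sigma>]
  have N: "0 \<le> 4 * N + \<rho> / 2 * (9 * N)"
    using n_kappa_lam_ge rho_bounds by (intro add_nonneg_nonneg) auto
  have "ennreal (4 * N + \<rho> / 2 * (9 * N)) * I
      \<le> ennreal (4 * N + \<rho> / 2 * (9 * N)) * (ennreal (1 / \<sigma>) * e2ennreal (err x y))"
    by (intro mult_left_mono I) auto
  also have "\<dots> = ennreal ((4 * N + \<rho> / 2 * (9 * N)) / \<sigma>) * e2ennreal (err x y)"
    using N \<sigma>'(1) by (simp add: mult.assoc[symmetric] flip: ennreal_mult)
  also have "\<dots> \<le> ennreal ((1 - \<rho> / 2) * (\<rho> / 2)) * e2ennreal (err x y)"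
    by (intro mult_right_mono ennreal_leI \<sigma>') auto
  also have "\<dots> = ennreal (1 - \<rho> / 2) * (ennreal (\<rho> / 2) * e2ennreal (err x y))"
    using rho_bounds by (subst ennreal_mult) (simp_all add: mult.assoc)
  finally show ?thesis
    using rho_bounds x primal_opt_le[OF x]
    by (simp add: potential_def distrib_left ennreal_mult)
qed

lemma potential_init:
  assumes x: "x \<in> carrier_vec d"
  shows "potential x (yhat n d a \<phi> x) \<le> ennreal ((1 + N) * subopt x)"
proof -
  have h0: "0 \<le> subopt x" using primal_opt_le x by auto
  have N0: "0 \<le> N" using n_kappa_lam_ge by linarith
  have "potential x (yhat n d a \<phi> x) \<le> ennreal (subopt x) + ennreal (1 / 2) * ennreal (2 * N * subopt x)"
    unfolding potential_def using e2ennreal_mono[OF err_init[OF x]] rho_bounds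
    by (intro add_mono mult_mono ennreal_leI) auto
  also have "ennreal (1 / 2) * ennreal (2 * N * subopt x) = ennreal (N * subopt x)"
    by (subst ennreal_mult'[symmetric]) (simp_all add: mult.assoc)
  also have "ennreal (subopt x) + ennreal (N * subopt x) = ennreal ((1 + N) * subopt x)"
    using h0 N0 by (simp add: distrib_right)
  finally show ?thesis .
qed

section \<open>Iteration count and running time\<close>

definition iterations :: "real \<Rightarrow> rvec \<Rightarrow> nat" where
  "iterations \<epsilon> x0 = nat \<lceil>4 * q * (ln (1 + N) + max 1 (ln (subopt x0 / \<epsilon>)))\<rceil>"

text \<open>The contraction factor is at most \<open>exp (- 1 / (4 * q))\<close>, which explains the
  factor \<open>4 * q\<close> in \<open>iterations\<close>; \<open>ln (1 + N)\<close> pays for the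
  initial potential. A zero initial error is treated apart, since its logarithm carries no
  information.\<close>

lemma iterations_suffice:
  assumes x0: "x0 \<in> carrier_vec d" and \<epsilon>: "0 < \<epsilon>"
  shows "(1 - \<rho> / 2) ^ iterations \<epsilon> x0 * ((1 + N) * subopt x0) \<le> \<epsilon>"
proof (cases "subopt x0 = 0")
  case False
  let ?h = "subopt x0" and ?T = "iterations \<epsilon> x0"
  have h: "0 < ?h" using False primal_opt_le[OF x0] by simp
  have N: "0 < 1 + N" using n_kappa_lam_ge by linarith
  have "4 * q * (ln (1 + N) + ln (?h / \<epsilon>)) \<le> 4 * q * (ln (1 + N) + max 1 (ln (?h / \<epsilon>)))"
    using q_ge_1 by (intro mult_left_mono) auto
  also have "\<dots> \<le> real ?T" unfolding iterations_def by (rule real_nat_ceiling_ge)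
  finally have T: "ln (1 + N) + ln (?h / \<epsilon>) \<le> real ?T / (4 * q)"
    using q_ge_1 by (simp add: pos_le_divide_eq mult.commute)
  have "(1 - \<rho> / 2) ^ ?T \<le> exp (- (1 / (4 * q))) ^ ?T"
  proof (intro power_mono)
    have "1 - \<rho> / 2 \<le> 1 + - (1 / (4 * q))" using rho_bounds(3) by simp
    also have "\<dots> \<le> exp (- (1 / (4 * q)))" by (rule exp_ge_add_one_self)
    finally show "1 - \<rho> / 2 \<le> exp (- (1 / (4 * q)))" .
  qed (use rho_bounds in auto)
  also have "\<dots> = exp (- (real ?T / (4 * q)))" by (simp flip: exp_of_nat_mult)
  also have "\<dots> \<le> exp (- (ln (1 + N) + ln (?h / \<epsilon>)))" using T by simp
  also have "\<dots> = \<epsilon> / ((1 + N) * ?h)"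
    using N h \<epsilon> by (simp add: exp_diff exp_minus exp_add field_simps)
  finally show ?thesis using N h by (simp add: pos_le_divide_eq)
qed (use \<epsilon> in auto)

text \<open>There are \<open>T\<close> oracle calls and \<open>T + 1\<close> map evaluations, hence
  \<open>2 * T + 1\<close>. The constant is 27 = 8 * 3 + 2 + 1: the factor \<open>8 * q\<close> on
  \<open>2 * P + m\<close>, the doubled rounding error and the final 1.\<close>

lemma iterations_le:
  "2 * real (iterations \<epsilon> x0) + 1
    \<le> 27 * polylog 1 n L \<mu> lam R * (q * max 1 (ln (subopt x0 / \<epsilon>)))"
proof -
  define P where "P = polylog 1 n L \<mu> lam R"
  define m where "m = max 1 (ln (subopt x0 / \<epsilon>))"
  have P: "1 + \<bar>ln (real n)\<bar> + \<bar>ln L\<bar> + \<bar>ln lam\<bar> + \<bar>ln R\<bar> \<le> P" by (simp add: P_def polylog_def)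
  have P1: "1 \<le> P" and m1: "1 \<le> m" using P by (auto simp: m_def)
  have ln2: "ln 2 \<le> (1::real)" using ln_le_minus_one[of 2] by simp
  \<comment> \<open>Bounding the ceiling by a product turns its logarithm into a sum of logarithms
    of the parameters.\<close>
  have "ln \<kappa>lam \<le> ln (2 * max 1 (L * R\<^sup>2 / lam))"
  proof (rule ln_mono)
    show "\<kappa>lam \<le> 2 * max 1 (L * R\<^sup>2 / lam)" by linarith
  qed (use kappa_lam_ge in linarith)
  also have "\<dots> = ln 2 + ln (max 1 (L * R\<^sup>2 / lam))" by (intro ln_mult_pos) auto
  also have "ln (max 1 (L * R\<^sup>2 / lam)) \<le> \<bar>ln (L * R\<^sup>2 / lam)\<bar>" by (simp add: max_def)
  also have "ln (L * R\<^sup>2 / lam) = ln L + 2 * ln R - ln lam"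
    using L_pos R_pos lam_pos by (simp add: ln_div ln_mult_pos ln_realpow)
  finally have k: "ln \<kappa>lam \<le> 1 + \<bar>ln L\<bar> + 2 * \<bar>ln R\<bar> + \<bar>ln lam\<bar>" using ln2 by linarith
  have "ln (1 + N) \<le> ln (2 * N)"
    using n_kappa_lam_ge by (intro ln_mono) auto
  also have "\<dots> = ln 2 + ln (real n) + ln \<kappa>lam"
    using n_pos kappa_lam_ge by (simp add: ln_mult_pos)
  finally have lnN: "ln (1 + N) \<le> 2 * P" using k P ln2 by linarith
  have "0 \<le> ln (1 + N)" using n_kappa_lam_ge by (intro ln_ge_zero) linarith
  hence "0 \<le> 4 * q * (ln (1 + N) + m)" using q_ge_1 m1 by (intro mult_nonneg_nonneg) auto
  hence "real (iterations \<epsilon> x0) \<le> 4 * q * (ln (1 + N) + m) + 1"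
    unfolding iterations_def m_def[symmetric] by linarith
  also have "\<dots> \<le> 4 * q * (2 * P + m) + 1"
    using lnN q_ge_1 by simp
  finally have T: "real (iterations \<epsilon> x0) \<le> 4 * q * (2 * P + m) + 1" .
  have "q * (2 * P + m) \<le> q * (3 * (P * m))"
  proof (intro mult_left_mono)
    have "m \<le> P * m" "P \<le> P * m" using P1 m1 by (auto intro: mult_left_mono[of 1 m P, simplified])
    thus "2 * P + m \<le> 3 * (P * m)" by linarith
  qed (use q_ge_1 in simp)
  moreover have qm1: "1 \<le> q * m" using mult_mono[of 1 q 1 m, OF q_ge_1 m1] q_ge_1 by simp
  hence "1 \<le> P * (q * m)"
    using mult_mono[of 1 P 1 "q * m", OF P1 qm1] P1 qm1 by simp
  ultimately have "2 * real (iterations \<epsilon> x0) + 1 \<le> 27 * (P * (q * m))"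
    using T by (simp add: algebra_simps)
  thus ?thesis by (simp add: P_def m_def)
qed

lemma time_le:
  assumes "real \<tau> \<le> real m + real (iterations \<epsilon> x0) * (TD + real m)" and m: "real m \<le> TD"
  shows "real \<tau> \<le> 27 * polylog 1 n L \<mu> lam R * (TD * q * max 1 (ln (subopt x0 / \<epsilon>)))"
proof -
  have "real \<tau> \<le> TD + real (iterations \<epsilon> x0) * (TD + TD)"
    using assms by (intro order_trans[OF assms(1)] add_mono mult_left_mono) auto
  also have "\<dots> = (2 * real (iterations \<epsilon> x0) + 1) * TD" by (simp add: algebra_simps)
  also have "\<dots> \<le> (27 * polylog 1 n L \<mu> lam R * (q * max 1 (ln (subopt x0 / \<epsilon>)))) * TD"
    using m by (intro mult_right_mono iterations_le) auto
  finally show ?thesis by (simp add: mult_ac)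
qed

section \<open>Deterministic oracles\<close>

lemma dual_appa_invariant:
  assumes x0: "x0 \<in> carrier_vec d"
    and \<sigma>: "80 * (real n)\<^sup>2 * \<kappa>lam\<^sup>2 * max \<kappa> \<kappa>lam * q \<le> \<sigma>"
    and D: "dual_oracle n d a \<phi> \<sigma> lam TD D"
  shows "case dual_appa n d a \<phi> lam m D x0 t of (x, y, \<tau>) \<Rightarrow>
    x \<in> carrier_vec d \<and> y \<in> carrier_vec n \<and> real \<tau> \<le> real m + real t * (TD + real m) \<and>
    potential x y \<le> ennreal (1 - \<rho> / 2) ^ t * potential x0 (yhat n d a \<phi> x0)"
proof (induction t)
  case 0
  show ?case using x0 by simp
next
  case (Suc t)
  obtain x y \<tau> where s: "dual_appa n d a \<phi> lam m D x0 t = (x, y, \<tau>)" by (metis prod_cases3)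
  obtain y' c where c: "D x y = (y', c)" by force
  have x: "x \<in> carrier_vec d" and y: "y \<in> carrier_vec n"
    and \<tau>: "real \<tau> \<le> real m + real t * (TD + real m)"
    and pot: "potential x y \<le> ennreal (1 - \<rho> / 2) ^ t * potential x0 (yhat n d a \<phi> x0)"
    using Suc s by auto
  from D[unfolded dual_oracle_def] x y c
  have y': "y' \<in> carrier_vec n" and c': "real c \<le> TD"
    and err: "err x y' \<le> ereal (1 / \<sigma>) * err x y"
    by (metis fst_conv snd_conv)+
  have "e2ennreal (err x y') \<le> ennreal (1 / \<sigma>) * e2ennreal (err x y)"
    using e2ennreal_mono[OF err] accuracy_suffices(1)[OF \<sigma>] err_nonneg[of x y]
    by (simp add: e2ennreal_ereal_mult)
  from potential_contracts[OF x \<sigma> this] potential_after_oracle[OF x, of y']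
  have "potential (xhat n d a lam x y') y' \<le> ennreal (1 - \<rho> / 2) * potential x y"
    by (rule order_trans[rotated])
  also have "\<dots> \<le> ennreal (1 - \<rho> / 2) * (ennreal (1 - \<rho> / 2) ^ t * potential x0 (yhat n d a \<phi> x0))"
    by (intro mult_left_mono pot) auto
  finally show ?case
    using y' c' \<tau> by (simp add: s c mult_ac distrib_right)
qed

lemma potential_bound_final:
  assumes x0: "x0 \<in> carrier_vec d" and \<epsilon>: "0 < \<epsilon>"
  shows "ennreal (1 - \<rho> / 2) ^ iterations \<epsilon> x0 * potential x0 (yhat n d a \<phi> x0) \<le> ennreal \<epsilon>"
proof -
  have "ennreal (1 - \<rho> / 2) ^ iterations \<epsilon> x0 * potential x0 (yhat n d a \<phi> x0)
      \<le> ennreal (1 - \<rho> / 2) ^ iterations \<epsilon> x0 * ennreal ((1 + N) * subopt x0)"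
    by (intro mult_left_mono potential_init x0) auto
  also have "\<dots> = ennreal ((1 - \<rho> / 2) ^ iterations \<epsilon> x0 * ((1 + N) * subopt x0))"
    using rho_bounds by (simp add: ennreal_power ennreal_mult')
  also have "\<dots> \<le> ennreal \<epsilon>" by (intro ennreal_leI iterations_suffice x0 \<epsilon>)
  finally show ?thesis .
qed

theorem dual_appa_converges:
  assumes "x0 \<in> carrier_vec d" and \<epsilon>: "0 < \<epsilon>"
    and "80 * (real n)\<^sup>2 * \<kappa>lam\<^sup>2 * max \<kappa> \<kappa>lam * q \<le> \<sigma>"
    and "dual_oracle n d a \<phi> \<sigma> lam TD D" and m: "real m \<le> TD"
  shows "case dual_appa n d a \<phi> lam m D x0 (iterations \<epsilon> x0) of (x, y, \<tau>) \<Rightarrow>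
    subopt x \<le> \<epsilon> \<and> real \<tau> \<le> 27 * polylog 1 n L \<mu> lam R * (TD * q * max 1 (ln (subopt x0 / \<epsilon>)))"
proof -
  obtain x y \<tau> where s: "dual_appa n d a \<phi> lam m D x0 (iterations \<epsilon> x0) = (x, y, \<tau>)"
    by (metis prod_cases3)
  note inv = dual_appa_invariant[OF assms(1,3,4), of m "iterations \<epsilon> x0", unfolded s prod.case]
  have "ennreal (subopt x) \<le> ennreal \<epsilon>"
    using inv subopt_le_potential[of x y] potential_bound_final[OF assms(1,2)]
    by (meson order_trans)
  hence "subopt x \<le> \<epsilon>" using \<epsilon> by (simp add: ennreal_le_iff)
  thus ?thesis using inv time_le[OF _ m] s by simp
qed


section \<open>Randomized oracles\<close>

lemma continuous_on_loss: "i < n \<Longrightarrow> continuous_on UNIV (\<phi> i)"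
  using differentiable_loss
  by (auto intro!: continuous_at_imp_continuous_on differentiable_imp_continuous_within)

lemma borel_measurable_primal [measurable]: "F \<in> borel_measurable (borel_vec d)"
  unfolding primal_def
proof (rule borel_measurable_sum)
  fix i assume "i \<in> {..<n}"
  hence "\<phi> i \<in> borel_measurable borel"
    by (intro borel_measurable_continuous_onI continuous_on_loss) simp
  moreover have "dot d (a i) \<in> borel_measurable (borel_vec d)"
    unfolding dot_def by measurable
  ultimately show "(\<lambda>x. \<phi> i (dot d (a i) x)) \<in> borel_measurable (borel_vec d)"
    by (rule measurable_compose[rotated])
qed

text \<open>An infimum of uncountably many functions need not be measurable; \<^const>\<open>prox_opt\<close> is, since it is
  upper semicontinuous for the product topology on all of \<^typ>\<open>nat \<Rightarrow> real\<close>, on which it depends only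
  through the first \<open>d\<close> coordinates.\<close>

lemma borel_measurable_prox_opt [measurable]: "prox_opt \<in> borel_measurable (borel_vec d)"
proof -
  have bdd: "bdd_below (prox_obj s ` carrier_vec d)" for s
    by (intro bdd_belowI2[where m = Fmin] order_trans[OF primal_opt_le primal_le_prox_obj])
  have "prox_opt \<in> borel_measurable (borel :: rvec measure)"
  proof (rule borel_measurableI_less)
    fix c
    have "{s. prox_opt s < c} = (\<Union>x\<in>carrier_vec d. {s. prox_obj s x < c})"
      unfolding prox_opt_def by (subst cINF_less_iff[OF _ bdd]) (auto simp: PiE_eq_empty_iff)
    moreover have "open {s. prox_obj s x < c}" for x
      unfolding prox_obj_def
      by (intro open_Collect_less continuous_intros continuous_on_product_coordinates)
    ultimately show "{s \<in> space borel. prox_opt s < c} \<in> sets borel"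
      by (simp add: borel_open open_UN)
  qed
  moreover have "(\<lambda>s j. if j < d then s j else 0) \<in> borel_vec d \<rightarrow>\<^sub>M (borel :: rvec measure)"
  proof (subst measurable_cong_sets[OF refl sets_PiM_equal_borel[symmetric]], rule measurable_PiM_single')
    show "(\<lambda>s. if j < d then s j else 0) \<in> borel_measurable (borel_vec d)" for j
      by (cases "j < d") auto
  qed auto
  ultimately have "(\<lambda>s. prox_opt (\<lambda>j. if j < d then s j else 0)) \<in> borel_measurable (borel_vec d)"
    by (rule measurable_compose[rotated])
  moreover have "prox_opt (\<lambda>j. if j < d then s j else 0) = prox_opt s" for s
    by (simp add: prox_opt_def prox_obj_def)
  ultimately show ?thesis by simp
qed

lemma measurable_tmult [measurable]: "tmult n d a \<in> borel_vec n \<rightarrow>\<^sub>M borel_vec d"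
  unfolding tmult_def by measurable

lemma borel_measurable_tmult_component [measurable (raw)]:
  assumes f: "f \<in> S \<rightarrow>\<^sub>M borel_vec n" and j: "j \<in> {..<d}"
  shows "(\<lambda>p. tmult n d a (f p) j) \<in> borel_measurable S"
  by (rule measurable_compose[OF measurable_compose[OF f measurable_tmult] measurable_component_singleton[OF j]])

lemma measurable_xhat [measurable (raw)]:
  assumes [measurable]: "f \<in> S \<rightarrow>\<^sub>M borel_vec d" "h \<in> S \<rightarrow>\<^sub>M borel_vec n"
  shows "(\<lambda>p. xhat n d a lam (f p) (h p)) \<in> S \<rightarrow>\<^sub>M borel_vec d"
  unfolding xhat_def by measurable

lemma borel_measurable_err [measurable (raw)]:
  assumes [measurable]: "f \<in> S \<rightarrow>\<^sub>M borel_vec d" "h \<in> S \<rightarrow>\<^sub>M borel_vec n"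
  shows "(\<lambda>p. err (f p) (h p)) \<in> borel_measurable S"
  unfolding err_eq dual_def dot_def power2_L2_set by measurable

lemma borel_measurable_potential [measurable (raw)]:
  assumes [measurable]: "f \<in> S \<rightarrow>\<^sub>M borel_vec d" "h \<in> S \<rightarrow>\<^sub>M borel_vec n"
  shows "(\<lambda>p. potential (f p) (h p)) \<in> borel_measurable S"
  unfolding potential_def by measurable

section \<open>One iteration as a Markov kernel, and its composition\<close>

context
  fixes \<sigma> TD :: real and m :: nat and K
  assumes \<sigma>: "80 * (real n)\<^sup>2 * \<kappa>lam\<^sup>2 * max \<kappa> \<kappa>lam * q \<le> \<sigma>"
    and K: "randomized_dual_oracle n d a \<phi> \<sigma> lam TD K"
begin

abbreviation update :: "rvec \<Rightarrow> nat \<Rightarrow> rvec \<times> nat \<Rightarrow> rvec \<times> rvec \<times> nat" where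
  "update x \<tau> r \<equiv> (xhat n d a lam x (fst r), fst r, \<tau> + snd r + m)"

text \<open>Projections replace the patterns of the algorithm so that one iteration is a single
  measurable kernel on \<open>appa_space n d\<close>.\<close>

definition step :: "rvec \<times> rvec \<times> nat \<Rightarrow> (rvec \<times> rvec \<times> nat) measure" where
  "step p = K (fst p) (fst (snd p)) \<bind>
     (\<lambda>r. return (appa_space n d) (update (fst p) (snd (snd p)) r))"

lemma kernel_measurable:
  "(\<lambda>(s, y). K s y) \<in> borel_vec d \<Otimes>\<^sub>M borel_vec n
      \<rightarrow>\<^sub>M prob_algebra (borel_vec n \<Otimes>\<^sub>M count_space UNIV)"
  using K by (simp add: randomized_dual_oracle_def)

lemma step_measurable: "step \<in> appa_space n d \<rightarrow>\<^sub>M prob_algebra (appa_space n d)"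
proof -
  have 1: "(\<lambda>p. K (fst p) (fst (snd p))) \<in> appa_space n d
      \<rightarrow>\<^sub>M prob_algebra (borel_vec n \<Otimes>\<^sub>M count_space UNIV)"
    using measurable_compose[OF _ kernel_measurable, of "\<lambda>p. (fst p, fst (snd p))" "appa_space n d"]
    by simp
  have 2: "(\<lambda>(p, r). update (fst p) (snd (snd p)) r) \<in>
      appa_space n d \<Otimes>\<^sub>M (borel_vec n \<Otimes>\<^sub>M count_space UNIV) \<rightarrow>\<^sub>M appa_space n d"
    unfolding case_prod_beta by measurable
  show ?thesis
    unfolding step_def
    using measurable_compose[OF 2 measurable_return_prob_space]
    by (intro measurable_bind_prob_space2[OF 1]) (simp add: case_prod_beta)
qed

lemma randomized_dual_appa_Suc:
  "randomized_dual_appa n d a \<phi> lam m K x0 (Suc t) = randomized_dual_appa n d a \<phi> lam m K x0 t \<bind> step"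
proof -
  have "step = (\<lambda>(x, y, \<tau>). K x y \<bind>
      (\<lambda>(y', c). return (appa_space n d) (xhat n d a lam x y', y', \<tau> + c + m)))"
    by (simp add: fun_eq_iff step_def case_prod_unfold)
  thus ?thesis by simp
qed

context
  fixes x y :: rvec and \<tau> :: nat
  assumes x: "x \<in> carrier_vec d" and y: "y \<in> carrier_vec n"
begin

lemma kernel_prob_space: "prob_space (K x y)" "sets (K x y) = sets (borel_vec n \<Otimes>\<^sub>M count_space UNIV)"
  using measurable_space[OF kernel_measurable, of "(x, y)"] x y
  by (auto simp: space_pair_measure space_PiM space_prob_algebra)

lemma update_measurable: 
  "(\<lambda>r. return (appa_space n d) (update x \<tau> r)) \<in> K x y \<rightarrow>\<^sub>M subprob_algebra (appa_space n d)"
proof -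
  have [measurable]: "x \<in> space (borel_vec d)" using x by (simp add: space_PiM)
  have "update x \<tau> \<in> borel_vec n \<Otimes>\<^sub>M count_space UNIV \<rightarrow>\<^sub>M appa_space n d" by measurable
  from measurable_compose[OF this return_measurable] show ?thesis
    by (simp add: measurable_cong_sets[OF kernel_prob_space(2) refl])
qed

lemma update_in_space:
  assumes "r \<in> space (K x y)"
  shows "update x \<tau> r \<in> space (appa_space n d)"
  using assms sets_eq_imp_space_eq[OF kernel_prob_space(2)]
  by (auto simp: space_pair_measure space_PiM)

lemma nn_integral_step:
  assumes f: "f \<in> borel_measurable (appa_space n d)"
  shows "(\<integral>\<^sup>+ p. f p \<partial>step (x, y, \<tau>)) = (\<integral>\<^sup>+ r. f (update x \<tau> r) \<partial>K x y)"
  unfolding step_def fst_conv snd_conv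
  by (subst nn_integral_bind[OF f update_measurable])
     (intro nn_integral_cong nn_integral_return update_in_space f)

text \<open>The affine bound is integrated over the oracle output: its constant term survives
  because the kernel has mass one, and the oracle guarantee bounds exactly the remaining
  integral.\<close>

lemma potential_step:
  "(\<integral>\<^sup>+ p. potential (fst p) (fst (snd p)) \<partial>step (x, y, \<tau>)) \<le> ennreal (1 - \<rho> / 2) * potential x y"
proof -
  interpret K: prob_space "K x y" by (rule kernel_prob_space)
  have [measurable]: "x \<in> space (borel_vec d)" using x by (simp add: space_PiM)
  have [measurable_cong]: "sets (K x y) = sets (borel_vec n \<Otimes>\<^sub>M count_space UNIV)"
    by (rule kernel_prob_space)
  let ?A = "ennreal ((1 - \<rho> / 2) * subopt x)" and ?c = "ennreal (4 * N + \<rho> / 2 * (9 * N))"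
  have "(\<integral>\<^sup>+ p. potential (fst p) (fst (snd p)) \<partial>step (x, y, \<tau>))
      = (\<integral>\<^sup>+ r. potential (xhat n d a lam x (fst r)) (fst r) \<partial>K x y)"
    by (subst nn_integral_step) auto
  also have "\<dots> \<le> (\<integral>\<^sup>+ r. ?A + ?c * e2ennreal (err x (fst r)) \<partial>K x y)"
    by (intro nn_integral_mono potential_after_oracle x)
  also have "\<dots> = ?A + ?c * (\<integral>\<^sup>+ r. e2ennreal (err x (fst r)) \<partial>K x y)"
    by (simp add: nn_integral_add nn_integral_cmult K.emeasure_space_1)
  also have "\<dots> \<le> ennreal (1 - \<rho> / 2) * potential x y"
  proof (rule potential_contracts[OF x \<sigma>])
    have "0 < \<sigma>" by (rule accuracy_suffices[OF \<sigma>])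
    thus "(\<integral>\<^sup>+ r. e2ennreal (err x (fst r)) \<partial>K x y) \<le> ennreal (1 / \<sigma>) * e2ennreal (err x y)"
      using K x y err_nonneg[of x y] 
      by (simp add: randomized_dual_oracle_def flip: e2ennreal_ereal_mult)
  qed
  finally show ?thesis .
qed

lemma time_step: "AE p in step (x, y, \<tau>). real (snd (snd p)) \<le> real \<tau> + (TD + real m)"
proof -
  have "AE r in K x y. real (snd r) \<le> TD"
    using K x y by (simp add: randomized_dual_oracle_def)
  moreover have "AE r in K x y. r \<in> space (K x y)" by (rule AE_space)
  ultimately have "AE r in K x y. AE p in return (appa_space n d) (update x \<tau> r).
      real (snd (snd p)) \<le> real \<tau> + (TD + real m)"
  proof eventually_elim
    case (elim r)
    thus ?case by (subst AE_return[OF update_in_space]) auto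
  qed
  thus ?thesis
    unfolding step_def fst_conv snd_conv by (subst AE_bind[OF update_measurable]) auto
qed

end

text \<open>The next lemma takes from this the sigma-algebra of the state distribution.\<close>

lemma randomized_dual_appa_in_prob_algebra:
  assumes "x0 \<in> carrier_vec d"
  shows "randomized_dual_appa n d a \<phi> lam m K x0 t \<in> space (prob_algebra (appa_space n d))"
proof (induction t)
  case 0
  have "(x0, yhat n d a \<phi> x0, m) \<in> space (appa_space n d)"
    using assms by (simp add: space_pair_measure space_PiM)
  thus ?case by (simp add: space_prob_algebra prob_space_return)
next
  case (Suc t)
  have "(\<lambda>S. S \<bind> step) \<in> prob_algebra (appa_space n d) \<rightarrow>\<^sub>M prob_algebra (appa_space n d)"
    by (rule measurable_bind_prob_space[OF measurable_ident_sets[OF refl] step_measurable])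
  from measurable_space[OF this Suc] show ?case
    by (simp only: randomized_dual_appa_Suc)
qed

text \<open>The integral over a bind is an iterated integral; \<open>potential_step\<close> bounds
  the inner one for each state, and the induction hypothesis bounds the outer one.\<close>

lemma randomized_dual_appa_invariant:
  assumes x0: "x0 \<in> carrier_vec d"
  shows "(\<integral>\<^sup>+ p. potential (fst p) (fst (snd p)) \<partial>randomized_dual_appa n d a \<phi> lam m K x0 t)
      \<le> ennreal (1 - \<rho> / 2) ^ t * potential x0 (yhat n d a \<phi> x0)" (is "?I t")
    and "AE p in randomized_dual_appa n d a \<phi> lam m K x0 t.
      real (snd (snd p)) \<le> real m + real t * (TD + real m)" (is "?J t")
proof -
  let ?P = "randomized_dual_appa n d a \<phi> lam m K x0"
  have "?I t \<and> ?J t"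
  proof (induction t)
    case 0
    have "(x0, yhat n d a \<phi> x0, m) \<in> space (appa_space n d)"
      using x0 by (simp add: space_pair_measure space_PiM)
    thus ?case
      unfolding randomized_dual_appa.simps(1) by (simp add: nn_integral_return AE_return[where P = "\<lambda>p. snd (snd p) \<le> m"])
  next
    case (Suc t)
    have sets: "sets (?P t) = sets (appa_space n d)"
      using randomized_dual_appa_in_prob_algebra[OF x0] by (simp add: space_prob_algebra)
    note [measurable_cong] = sets
    have step: "step \<in> ?P t \<rightarrow>\<^sub>M subprob_algebra (appa_space n d)"
      using measurable_prob_algebraD[OF step_measurable] by (simp add: measurable_cong_sets[OF sets refl])
    have carrier: "fst p \<in> carrier_vec d" "fst (snd p) \<in> carrier_vec n" if "p \<in> space (?P t)" for p
      using that sets_eq_imp_space_eq[OF sets] by (auto simp: space_pair_measure space_PiM)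
    have "(\<integral>\<^sup>+ p. potential (fst p) (fst (snd p)) \<partial>?P (Suc t))
        = (\<integral>\<^sup>+ s. \<integral>\<^sup>+ p. potential (fst p) (fst (snd p)) \<partial>step s \<partial>?P t)"
      unfolding randomized_dual_appa_Suc by (rule nn_integral_bind[OF _ step]) measurable
    also have "\<dots> \<le> (\<integral>\<^sup>+ s. ennreal (1 - \<rho> / 2) * potential (fst s) (fst (snd s)) \<partial>?P t)"
    proof (rule nn_integral_mono)
      fix s assume "s \<in> space (?P t)"
      from potential_step[OF carrier[OF this], of "snd (snd s)"]
      show "(\<integral>\<^sup>+ p. potential (fst p) (fst (snd p)) \<partial>step s)
          \<le> ennreal (1 - \<rho> / 2) * potential (fst s) (fst (snd s))" by simp
    qed
    also have "\<dots> = ennreal (1 - \<rho> / 2) * (\<integral>\<^sup>+ s. potential (fst s) (fst (snd s)) \<partial>?P t)"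
      by (rule nn_integral_cmult) measurable
    also have "\<dots> \<le> ennreal (1 - \<rho> / 2) * (ennreal (1 - \<rho> / 2) ^ t * potential x0 (yhat n d a \<phi> x0))"
      using Suc by (intro mult_left_mono) auto
    finally have "?I (Suc t)" by (simp add: mult.assoc)
    moreover have "?J (Suc t)"
      unfolding randomized_dual_appa_Suc
    proof (subst AE_bind[OF step])
      have "AE s in ?P t. real (snd (snd s)) \<le> real m + real t * (TD + real m)" using Suc by simp
      \<comment> \<open>Almost every state lies in the carriers, where the oracle guarantees
        hold.\<close>
      moreover have "AE s in ?P t. s \<in> space (?P t)" by (rule AE_space)
      ultimately show "AE s in ?P t. AE p in step s. real (snd (snd p)) \<le> real m + real (Suc t) * (TD + real m)"
      proof eventually_elim
        case (elim s)
        from time_step[OF carrier[OF elim(2)], of "snd (snd s)"]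
        have "AE p in step s. real (snd (snd p)) \<le> real (snd (snd s)) + (TD + real m)"
          by (simp only: prod.collapse)
        thus ?case by eventually_elim (use elim(1) in \<open>simp add: distrib_right\<close>)
      qed
    qed measurable
    ultimately show ?case ..
  qed
  thus "?I t" "?J t" by auto
qed

theorem randomized_dual_appa_converges:
  assumes x0: "x0 \<in> carrier_vec d" and \<epsilon>: "0 < \<epsilon>" and m: "real m \<le> TD"
  defines "P \<equiv> randomized_dual_appa n d a \<phi> lam m K x0 (iterations \<epsilon> x0)"
  shows "(\<integral>\<^sup>+ (x, y, \<tau>). ennreal (subopt x) \<partial>P) \<le> ennreal \<epsilon>"
    and "AE (x, y, \<tau>) in P.
      real \<tau> \<le> 27 * polylog 1 n L \<mu> lam R * (TD * q * max 1 (ln (subopt x0 / \<epsilon>)))"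
proof -
  have "(\<integral>\<^sup>+ (x, y, \<tau>). ennreal (subopt x) \<partial>P) \<le> (\<integral>\<^sup>+ p. potential (fst p) (fst (snd p)) \<partial>P)"
    by (intro nn_integral_mono) (auto simp: subopt_le_potential)
  also have "\<dots> \<le> ennreal \<epsilon>"
    unfolding P_def
    by (rule order_trans[OF randomized_dual_appa_invariant(1)[OF x0] potential_bound_final[OF x0 \<epsilon>]])
  finally show "(\<integral>\<^sup>+ (x, y, \<tau>). ennreal (subopt x) \<partial>P) \<le> ennreal \<epsilon>" .
  from randomized_dual_appa_invariant(2)[OF x0, of "iterations \<epsilon> x0"]
  show "AE (x, y, \<tau>) in P.
      real \<tau> \<le> 27 * polylog 1 n L \<mu> lam R * (TD * q * max 1 (ln (subopt x0 / \<epsilon>)))"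
    unfolding P_def[symmetric] case_prod_beta
    by eventually_elim (rule time_le[OF _ m])
qed

end
end

text \<open>The number of iterations depends on the problem, \<epsilon> and \<open>x0\<close> alone,
  so one \<open>T\<close> serves every oracle, deterministic or randomized.\<close>

theorem theorem4p3:
  "\<exists>(C::real) (k::nat).
   \<forall>(n::nat) (d::nat) (a :: nat \<Rightarrow> rvec) (\<phi> :: nat \<Rightarrow> real \<Rightarrow> real)
    (L::real) (\<mu>::real) (lam::real) (\<epsilon>::real) (x0::rvec).
     let R = max_row_norm n d a;
         \<kappa> = real_of_int \<lceil>L * R\<^sup>2 / \<mu>\<rceil>;
         \<kappa>lam = real_of_int \<lceil>L * R\<^sup>2 / lam\<rceil>;
         q = real_of_int \<lceil>lam / \<mu>\<rceil>;
         F = primal n d a \<phi>;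
         Fmin = primal_opt n d a \<phi>;
         \<epsilon>0 = F x0 - Fmin
     in
     0 < n \<longrightarrow> 0 < d \<longrightarrow> 0 < \<mu> \<longrightarrow> 0 < lam \<longrightarrow> 0 < \<epsilon> \<longrightarrow>
     x0 \<in> carrier_vec d \<longrightarrow>
     (\<forall>i<n. convex_on UNIV (\<phi> i) \<and> L_smooth L (\<phi> i)) \<longrightarrow>
     strongly_convex d \<mu> F \<longrightarrow>
     (\<exists>T::nat. \<forall>(\<sigma>::real) (TD::real) (m::nat).
        let time_bound = C * polylog k n L \<mu> lam R * (TD * q * max 1 (ln (\<epsilon>0 / \<epsilon>)))
        in
        80 * (real n)\<^sup>2 * \<kappa>lam\<^sup>2 * max \<kappa> \<kappa>lam * q \<le> \<sigma> \<longrightarrow>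
        real m \<le> TD \<longrightarrow>
        (\<forall>D. dual_oracle n d a \<phi> \<sigma> lam TD D \<longrightarrow>
           (case dual_appa n d a \<phi> lam m D x0 T of (x, y, \<tau>) \<Rightarrow>
              F x - Fmin \<le> \<epsilon> \<and> real \<tau> \<le> time_bound)) \<and>
        (\<forall>K. randomized_dual_oracle n d a \<phi> \<sigma> lam TD K \<longrightarrow>
           (\<integral>\<^sup>+ (x, y, \<tau>). ennreal (F x - Fmin) \<partial>randomized_dual_appa n d a \<phi> lam m K x0 T)
              \<le> ennreal \<epsilon> \<and>
           (AE (x, y, \<tau>) in randomized_dual_appa n d a \<phi> lam m K x0 T.
              real \<tau> \<le> time_bound)))"
proof -
  \<comment> \<open>The claim with its \<open>let\<close> bindings expanded and the constants 27 and
    1 of \<open>iterations_le\<close> inserted, ready for resolution.\<close>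
  have main: "\<exists>T::nat. \<forall>(\<sigma>::real) (TD::real) (m::nat).
      80 * (real n)\<^sup>2 * (real_of_int \<lceil>L * (max_row_norm n d a)\<^sup>2 / lam\<rceil>)\<^sup>2 *
        max (real_of_int \<lceil>L * (max_row_norm n d a)\<^sup>2 / \<mu>\<rceil>) (real_of_int \<lceil>L * (max_row_norm n d a)\<^sup>2 / lam\<rceil>) *
        real_of_int \<lceil>lam / \<mu>\<rceil> \<le> \<sigma> \<longrightarrow>
      real m \<le> TD \<longrightarrow>
      (\<forall>D. dual_oracle n d a \<phi> \<sigma> lam TD D \<longrightarrow>
         (case dual_appa n d a \<phi> lam m D x0 T of (x, y, \<tau>) \<Rightarrow>
            primal n d a \<phi> x - primal_opt n d a \<phi> \<le> \<epsilon> \<and>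
            real \<tau> \<le> 27 * polylog 1 n L \<mu> lam (max_row_norm n d a) * (TD * real_of_int \<lceil>lam / \<mu>\<rceil> *
              max 1 (ln ((primal n d a \<phi> x0 - primal_opt n d a \<phi>) / \<epsilon>))))) \<and>
      (\<forall>K. randomized_dual_oracle n d a \<phi> \<sigma> lam TD K \<longrightarrow>
         (\<integral>\<^sup>+ (x, y, \<tau>). ennreal (primal n d a \<phi> x - primal_opt n d a \<phi>)
             \<partial>randomized_dual_appa n d a \<phi> lam m K x0 T) \<le> ennreal \<epsilon> \<and>
         (AE (x, y, \<tau>) in randomized_dual_appa n d a \<phi> lam m K x0 T.
            real \<tau> \<le> 27 * polylog 1 n L \<mu> lam (max_row_norm n d a) * (TD * real_of_int \<lceil>lam / \<mu>\<rceil> *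
              max 1 (ln ((primal n d a \<phi> x0 - primal_opt n d a \<phi>) / \<epsilon>)))))"
    if "0 < n" "0 < d" "0 < \<mu>" "0 < lam" and \<epsilon>: "0 < \<epsilon>" and x0: "x0 \<in> carrier_vec d"
      "\<forall>i<n. convex_on UNIV (\<phi> i) \<and> L_smooth L (\<phi> i)" "strongly_convex d \<mu> (primal n d a \<phi>)"
    for n d :: nat and a :: "nat \<Rightarrow> rvec" and \<phi> :: "nat \<Rightarrow> real \<Rightarrow> real" and L \<mu> lam \<epsilon> :: real and x0 :: rvec
  proof -
    interpret erm n d a \<phi> L \<mu> lam
      using that by unfold_locales auto
    show ?thesis
      by (intro exI[of _ "iterations \<epsilon> x0"] allI impI conjI
            dual_appa_converges[OF x0(1) \<epsilon>] randomized_dual_appa_converges[OF _ _ x0(1) \<epsilon>])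
  qed
  show ?thesis
    unfolding Let_def by (rule exI[of _ 27], rule exI[of _ 1], intro allI impI, rule main)
qed

end
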